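(* Fix $1\le p<2$. There exist constants $c_p>0$ and $\kappa_p\ge 1$ depending only on $p$ such that for all integers $d\ge 1$ and $n\ge 1$, with $r=\lceil \exp(\exp(c_p d))\rceil$, there is an $\ell_p$ oblivious subspace embedding over $r\times n$ matrices with distortion at most $\kappa_p$. Specifically, if $\Pi$ has i.i.d. entries distributed as $(r\log r)^{-1/p}X$ with $X\sim\mathcal{D}_p$, then there are constants $0<a_p\le b_p$ (depending only on $p$, with $b_p/a_p\le\kappa_p$) such that for every fixed $A\in\mathbb{R}^{n\times d}$, with probability at least $0.99$, $a_p\|Ax\|_p\le\|\Pi Ax\|_p\le b_p\|Ax\|_p$ for all $x\in\mathbb{R}^d$.
   Context: $\mathcal{D}_p$ denotes the standard symmetric $p$-stable distribution: if $X_1,\dots,X_m$ are i.i.d. $\sim\mathcal{D}_p$ and $a\in\mathbb{R}^m$, then $\sum_i a_iX_i$ has the same distribution as $(\sum_i|a_i|^p)^{1/p}X$ with $X\sim\mathcal{D}_p$ ($\mathcal{D}_1$ is the standard Cauchy distribution). A distribution over $r\times n$ real matrices $\Pi$ is an $\ell_p$ oblivious subspace embedding (for $n\times d$ matrices) with distortion $\kappa$ if for every fixed $A\in\mathbb{R}^{n\times d}$, $\Pr_{\Pi}[\|Ax\|_p \le \|\Pi A x\|_p \le \kappa\|Ax\|_p \ \forall x\in\mathbb{R}^d] \ge 0.99$; rescaling $\Pi$ by a constant is allowed, so a two-sided bound $a\|Ax\|_p\le\|\Pi Ax\|_p\le b\|Ax\|_p$ gives distortion $b/a$. *)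

theory Defs
  imports "HOL-Probability.Probability"
begin

text \<open>The standard symmetric p-stable distribution D_p: the real probability
  distribution with characteristic function t -> exp(-|t|^p). For p = 1 this is
  the standard Cauchy distribution; this normalisation satisfies the stability
  property sum a_i X_i ~ (sum |a_i|^p)^(1/p) X. By Levy uniqueness it is unique.\<close>
definition std_sym_p_stable :: "real \<Rightarrow> real measure \<Rightarrow> bool" where
  "std_sym_p_stable p D \<longleftrightarrow>
     real_distribution D \<and> (\<forall>t. char D t = complex_of_real (exp (- (\<bar>t\<bar> powr p))))"

definition lp_norm :: "real \<Rightarrow> nat \<Rightarrow> (nat \<Rightarrow> real) \<Rightarrow> real" where
  "lp_norm p m v = (\<Sum>i<m. \<bar>v i\<bar> powr p) powr (1 / p)"

definition mat_vec :: "nat \<Rightarrow> (nat \<Rightarrow> nat \<Rightarrow> real) \<Rightarrow> (nat \<Rightarrow> real) \<Rightarrow> nat \<Rightarrow> real" where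
  "mat_vec k M v = (\<lambda>i. \<Sum>j<k. M i j * v j)"

end

theory Submission
  imports Defs
begin

text \<open>For a fixed vector of norm 1 the sketch has independent \<open>p\<close>-stable coordinates \<open>Z i\<close>, and
  \<open>\<bar>Z i\<bar> powr p\<close> has a tail of order \<open>1 / t\<close>. Truncated at \<open>r * ln r\<close> these powers have mean
  of order \<open>ln r\<close> and second moment of order \<open>r * ln r\<close>, so by Chebyshev's inequality their sum is of
  order \<open>r * ln r\<close> outside an event of probability \<open>O(1 / ln r)\<close>. As \<open>ln r \<ge> exp (c * d)\<close>, this
  survives a union bound over a net of \<open>exp (O(d))\<close> points of the unit ball of the column space, and
  since the two bounds hold on the net with constant distortion, a net of constant fineness suffices.

  The moments are computed from the characteristic function alone, by comparing functions of \<open>x\<close> with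
  sums of \<open>1 - cos (x / 2 ^ k)\<close>, whose expectations are known. The net is obtained by counting
  lattice points, which replaces the usual volume argument.\<close>

section \<open>Tails and truncated moments of stable distributions\<close>

text \<open>The \<open>p\<close>-th power of a stable variable has infinite mean, so moments exist
  only after truncation. The level \<open>T = r * ln r\<close> balances two errors: some power
  exceeds it with probability \<open>O(r / T)\<close>, and the truncated sum has variance
  \<open>O(r * T)\<close> against a mean of order \<open>T\<close>; both errors are
  \<open>O(1 / ln r)\<close>. No smaller failure probability is at hand, so \<open>ln r\<close>
  itself has to beat the size of the net, and this is where the double exponential comes from. Two
  obstacles shape the second half. The map from \<open>x\<close> to the norm of \<open>A x\<close>
  may vanish off 0, and the event for all \<open>x\<close> is an uncountable intersection. Both are
  met by fixing a finite set of vectors first: a genuine norm is chosen that agrees with the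
  seminorm up to a factor 2 on those of them outside the kernel. The norm and its net depend on the
  finite set, the probability bound does not, so it survives a limit to all rational vectors and
  then to all real ones.\<close>

lemma stable_integral_cos:
  assumes "std_sym_p_stable p D"
  shows "integrable D (\<lambda>x. 1 - cos (t * x))"
    and "(\<integral>x. 1 - cos (t * x) \<partial>D) = 1 - exp (- (\<bar>t\<bar> powr p))"
proof -
  interpret real_distribution D using assms by (simp add: std_sym_p_stable_def)
  have int: "integrable D (\<lambda>x. iexp (t * x))"
    using integrable_iexp[of "\<lambda>x. complex_of_real (t * x)"] by simp
  have intc: "integrable D (\<lambda>x. cos (t * x))"
    by (intro integrable_const_bound[of _ 1]) auto
  show "integrable D (\<lambda>x. 1 - cos (t * x))" using intc by simp
  have "(\<integral>x. cos (t * x) \<partial>D) = Re (char D t)"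
    unfolding char_def by (subst integral_Re[OF int, symmetric]) (simp add: Re_exp)
  also have "\<dots> = exp (- (\<bar>t\<bar> powr p))"
    using assms by (simp add: std_sym_p_stable_def)
  finally show "(\<integral>x. 1 - cos (t * x) \<partial>D) = 1 - exp (- (\<bar>t\<bar> powr p))"
    using intc prob_space by simp
qed

lemma one_minus_cos_ge:
  fixes w :: real
  assumes "1 < \<bar>w\<bar>" "\<bar>w\<bar> \<le> 2"
  shows "1 - cos 1 \<le> 1 - cos w"
proof -
  have "cos \<bar>w\<bar> \<le> cos 1"
    using assms pi_gt3 by (intro cos_monotone_0_pi_le) auto
  then show ?thesis by simp
qed

text \<open>Covers the tail by the shells \<open>\<tau> * 2 ^ j < \<bar>x\<bar> \<le> 2 * \<tau> * 2 ^ j\<close>, on each of which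
  \<open>1 - cos (x / (\<tau> * 2 ^ j))\<close> is bounded away from 0.\<close>
lemma stable_tail:
  assumes "std_sym_p_stable p D" "1 \<le> p" "0 < \<tau>"
  shows "measure D {x. \<tau> < \<bar>x\<bar>} \<le> 2 / (1 - cos 1) * \<tau> powr (- p)"
proof -
  interpret real_distribution D using assms by (simp add: std_sym_p_stable_def)
  define \<theta> where "\<theta> = 1 - cos (1::real)"
  have \<theta>: "\<theta> > 0" unfolding \<theta>_def using cos_monotone_0_pi[of 0 1] pi_gt3 by simp
  define S where "S j = {x::real. \<tau> * 2 ^ j < \<bar>x\<bar> \<and> \<bar>x\<bar> \<le> \<tau> * 2 ^ Suc j}" for j
  have S_sets[measurable]: "S j \<in> sets D" for j unfolding S_def by simp
  have shell: "measure D (S j) \<le> \<tau> powr (- p) / \<theta> * (1/2) ^ j" for j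
  proof -
    define t where "t = inverse (\<tau> * 2 ^ j)"
    have t: "t > 0" using assms by (simp add: t_def)
    have "\<theta> * measure D (S j) = (\<integral>x. \<theta> * indicator (S j) x \<partial>D)"
      by (simp add: S_sets)
    also have "\<dots> \<le> (\<integral>x. 1 - cos (t * x) \<partial>D)"
    proof (rule integral_mono)
      show "integrable D (\<lambda>x. \<theta> * indicator (S j) x)"
        by (intro integrable_mult_right) (auto intro!: integrable_const_bound[of _ 1] simp: indicator_def)
      show "\<theta> * indicator (S j) x \<le> 1 - cos (t * x)" for x
      proof (cases "x \<in> S j")
        case True
        then have "1 < \<bar>t * x\<bar> \<and> \<bar>t * x\<bar> \<le> 2"
          using assms by (auto simp: S_def t_def abs_mult field_simps)
        then show ?thesis using True one_minus_cos_ge[of "t * x"] by (simp add: \<theta>_def)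
      qed (simp add: S_def)
    qed (rule stable_integral_cos[OF assms(1)])
    also have "\<dots> = 1 - exp (- (t powr p))"
      using stable_integral_cos(2)[OF assms(1), of t] t by simp
    also have "\<dots> \<le> t powr p" using exp_ge_add_one_self[of "- (t powr p)"] by simp
    also have "\<dots> = \<tau> powr (- p) * (2 ^ j) powr (- p)"
      using assms by (simp add: t_def powr_mult powr_minus inverse_powr)
    \<comment> \<open>Weakening the exponent from \<open>- p\<close> to \<open>- 1\<close> makes the
      shells a geometric series with sum 2, whatever \<open>p\<close> is.\<close>
    also have "(2 ^ j) powr (- p) \<le> (2 ^ j) powr (- 1 :: real)"
      using assms by (intro powr_mono) auto
    also have "(2 ^ j) powr (- 1 :: real) = (1/2) ^ j"
      by (simp add: powr_minus power_divide field_simps)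
    finally have "\<theta> * measure D (S j) \<le> \<tau> powr (- p) * (1/2) ^ j" by (simp add: mult_left_mono)
    then show ?thesis using \<theta> by (simp add: field_simps)
  qed
  have "{x. \<tau> < \<bar>x\<bar>} \<subseteq> (\<Union>j. S j)"
  proof
    fix x :: real assume "x \<in> {x. \<tau> < \<bar>x\<bar>}"
    then have x: "\<tau> < \<bar>x\<bar>" by simp
    define m where "m = (LEAST m. \<bar>x\<bar> \<le> \<tau> * 2 ^ m)"
    have "\<exists>m. \<bar>x\<bar> / \<tau> < 2 ^ m" by (rule real_arch_pow) simp
    then have ex: "\<exists>m. \<bar>x\<bar> \<le> \<tau> * 2 ^ m"
      using assms by (auto simp: field_simps intro: less_imp_le)
    have m: "\<bar>x\<bar> \<le> \<tau> * 2 ^ m" unfolding m_def using ex by (rule LeastI_ex)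
    then have "m \<noteq> 0" using x by (cases m) auto
    then obtain j where j: "m = Suc j" by (cases m) auto
    have "\<not> \<bar>x\<bar> \<le> \<tau> * 2 ^ j" using j not_less_Least[of j "\<lambda>m. \<bar>x\<bar> \<le> \<tau> * 2 ^ m"] unfolding m_def by auto
    then have "x \<in> S j" using m j by (simp add: S_def)
    then show "x \<in> (\<Union>j. S j)" by blast
  qed
  then have tail_le: "measure D {x. \<tau> < \<bar>x\<bar>} \<le> measure D (\<Union>j. S j)"
    using S_sets by (intro finite_measure_mono sets.countable_UN) auto
  have sm: "summable (\<lambda>j. \<tau> powr (- p) / \<theta> * (1/2) ^ j)"
    by (intro summable_mult summable_geometric) simp
  have smS: "summable (\<lambda>j. measure D (S j))"
    by (rule summable_comparison_test'[OF sm, of 0]) (use shell in auto)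
  note tail_le
  also have "measure D (\<Union>j. S j) \<le> (\<Sum>j. measure D (S j))"
    by (intro finite_measure_subadditive_countably smS) (auto intro: S_sets[simplified])
  also have "\<dots> \<le> (\<Sum>j. \<tau> powr (- p) / \<theta> * (1/2) ^ j)"
    by (intro suminf_le shell smS sm)
  also have "\<dots> = \<tau> powr (- p) / \<theta> * 2"
    by (subst suminf_mult) (simp_all add: suminf_geometric summable_geometric)
  finally show ?thesis by (simp add: \<theta>_def field_simps)
qed

section \<open>Upper bounds on truncated moments by dyadic layers\<close>

lemma min_le_dyadic_sum:
  fixes w T :: real
  assumes "T \<le> 2 ^ K"
  shows "min w T \<le> 1 + (\<Sum>k<K. 2 ^ k * indicator {x. 2 ^ k < x} w)"
  using assms
proof (induction K arbitrary: T)
  case (Suc K)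
  have "0 \<le> (\<Sum>k<K. 2 ^ k * indicator {x. 2 ^ k < x} w :: real)" by (intro sum_nonneg) auto
  show ?case
  proof (cases "2 ^ K < w")
    case True
    have "1 + (\<Sum>k<K. 2 ^ k * indicator {x. 2 ^ k < x} w) \<ge> min w (2 ^ K)" by (rule Suc.IH) simp
    then show ?thesis using True Suc.prems by simp
  next
    case False
    then have "min w T \<le> min w (2 ^ K)" by simp
    also have "\<dots> \<le> 1 + (\<Sum>k<K. 2 ^ k * indicator {x. 2 ^ k < x} w)" by (rule Suc.IH) simp
    finally show ?thesis using False by simp
  qed
qed simp

text \<open>As for the first power, raising the cap from \<open>2 ^ K\<close> to
  \<open>2 ^ Suc K\<close> matters only if \<open>2 ^ K < w\<close>. It then adds at most
  \<open>2 ^ K\<close> to the minimum, and at most \<open>4 ^ Suc K - 4 ^ K = 3 * 4 ^ K\<close> to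
  its square.\<close>

lemma min_square_le_dyadic_sum:
  fixes w T :: real
  assumes "T \<le> 2 ^ K" "0 \<le> w" "0 \<le> T"
  shows "(min w T)\<^sup>2 \<le> 1 + (\<Sum>k<K. 3 * 4 ^ k * indicator {x. 2 ^ k < x} w)"
  using assms
proof (induction K arbitrary: T)
  case 0
  then have "(min w T)\<^sup>2 \<le> 1\<^sup>2" by (intro power_mono) auto
  then show ?case by simp
next
  case (Suc K)
  have sq: "(2 ^ K)\<^sup>2 = (4 ^ K :: real)" by (simp add: power2_eq_square flip: power_mult_distrib)
  show ?case
  proof (cases "2 ^ K < w")
    case True
    have IH: "1 + (\<Sum>k<K. 3 * 4 ^ k * indicator {x. 2 ^ k < x} w) \<ge> (min w (2 ^ K))\<^sup>2"
      by (rule Suc.IH) (use Suc.prems in auto)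
    have "(min w T)\<^sup>2 \<le> (2 ^ Suc K)\<^sup>2" using Suc.prems by (intro power_mono) auto
    also have "\<dots> = 4 * 4 ^ K" using sq by (simp add: power_mult_distrib)
    finally show ?thesis using True Suc.prems IH sq by simp
  next
    case False
    then have "(min w T)\<^sup>2 \<le> (min w (2 ^ K))\<^sup>2" using Suc.prems by (intro power_mono) auto
    also have "\<dots> \<le> 1 + (\<Sum>k<K. 3 * 4 ^ k * indicator {x. 2 ^ k < x} w)"
      by (rule Suc.IH) (use Suc.prems in auto)
    finally show ?thesis using False by simp
  qed
qed

text \<open>Under a tail \<open>C / t\<close> each of about \<open>log 2 T\<close> layers
  contributes at most \<open>C\<close> to the mean, which produces the logarithm. In the second
  moment layer \<open>k\<close> contributes at most \<open>3 * C * 2 ^ k\<close>, a geometric sum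
  governed by its top layer.\<close>

lemma (in prob_space) truncated_moments_le:
  fixes W :: "'a \<Rightarrow> real"
  assumes [measurable]: "W \<in> borel_measurable M" and W0: "\<And>x. 0 \<le> W x"
    and tail: "\<And>t. 1 \<le> t \<Longrightarrow> prob {x \<in> space M. t < W x} \<le> C / t"
    and "1 \<le> T"
  shows "expectation (\<lambda>x. min (W x) T) \<le> 1 + C * (1 + log 2 T)"
    and "expectation (\<lambda>x. (min (W x) T)\<^sup>2) \<le> (1 + 6 * C) * T"
proof -
  \<comment> \<open>Rounding up gives \<open>T <= 2 ^ K\<close>, as the layer bounds require, at the
    price \<open>2 ^ K <= 2 * T\<close>, which turns the factor 3 into 6.\<close>
  define K where "K = nat \<lceil>log 2 T\<rceil>"
  have l0: "0 \<le> log 2 T" using assms by simp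
  have Kl: "log 2 T \<le> K" "K \<le> 1 + log 2 T" using l0 by (auto simp: K_def) linarith+
  have "T = 2 powr (log 2 T)" using assms by simp
  also have "\<dots> \<le> 2 powr K" using Kl by (intro powr_mono) auto
  finally have TK: "T \<le> 2 ^ K" by (simp add: powr_realpow)
  have "(2::real) ^ K = 2 powr K" by (simp add: powr_realpow)
  also have "\<dots> \<le> 2 powr (1 + log 2 T)" using Kl by (intro powr_mono) auto
  also have "\<dots> = 2 * T" using assms by (simp add: powr_add)
  finally have KT: "2 ^ K \<le> 2 * T" .
  have C0: "0 \<le> C" using tail[of 1] order_trans[OF measure_nonneg[of M "{x \<in> space M. 1 < W x}"]] by simp
  have int_ind: "integrable M (\<lambda>x. indicator {y. 2 ^ k < y} (W x) :: real)" for k :: nat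
    by (intro integrable_const_bound[of _ 1]) (auto simp: indicator_def)
  have ind: "expectation (\<lambda>x. indicator {y. 2 ^ k < y} (W x)) \<le> C / 2 ^ k" for k :: nat
  proof -
    have "expectation (\<lambda>x. indicator {y. 2 ^ k < y} (W x))
        = expectation (indicator {x \<in> space M. 2 ^ k < W x})"
      by (intro Bochner_Integration.integral_cong) (auto simp: indicator_def)
    also have "\<dots> = prob {x \<in> space M. 2 ^ k < W x}" by simp
    finally show ?thesis using tail[of "2 ^ k"] by simp
  qed
  have int_sum: "integrable M (\<lambda>x. 1 + (\<Sum>k<K. c k * indicator {y. 2 ^ k < y} (W x)) :: real)"
    and exp_sum: "expectation (\<lambda>x. 1 + (\<Sum>k<K. c k * indicator {y. 2 ^ k < y} (W x)))
      = 1 + (\<Sum>k<K. c k * expectation (\<lambda>x. indicator {y. 2 ^ k < y} (W x)))" for c :: "nat \<Rightarrow> real"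
  proof -
    have i: "integrable M (\<lambda>x. c k * indicator {y. 2 ^ k < y} (W x))" for k
      using int_ind by (rule integrable_mult_right)
    show "integrable M (\<lambda>x. 1 + (\<Sum>k<K. c k * indicator {y. 2 ^ k < y} (W x)) :: real)"
      by (intro Bochner_Integration.integrable_add Bochner_Integration.integrable_sum i) auto
    have "expectation (\<lambda>x. 1 + (\<Sum>k<K. c k * indicator {y. 2 ^ k < y} (W x)))
        = 1 + expectation (\<lambda>x. \<Sum>k<K. c k * indicator {y. 2 ^ k < y} (W x))"
      by (subst Bochner_Integration.integral_add)
        (use prob_space in \<open>auto intro!: Bochner_Integration.integrable_sum i simp del: sum_mult_indicator\<close>)
    then show "expectation (\<lambda>x. 1 + (\<Sum>k<K. c k * indicator {y. 2 ^ k < y} (W x)))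
        = 1 + (\<Sum>k<K. c k * expectation (\<lambda>x. indicator {y. 2 ^ k < y} (W x)))"
      by (subst (asm) Bochner_Integration.integral_sum[OF i]) simp
  qed
  have "expectation (\<lambda>x. min (W x) T)
      \<le> expectation (\<lambda>x. 1 + (\<Sum>k<K. 2 ^ k * indicator {y. 2 ^ k < y} (W x)))"
  proof (intro integral_mono min_le_dyadic_sum TK)
    show "integrable M (\<lambda>x. min (W x) T)"
      using W0 assms by (intro integrable_const_bound[of _ T]) (auto intro!: AE_I2)
    show "integrable M (\<lambda>x. 1 + (\<Sum>k<K. 2 ^ k * indicator {y. 2 ^ k < y} (W x)) :: real)"
      by (rule int_sum)
  qed
  also have "\<dots> = 1 + (\<Sum>k<K. 2 ^ k * expectation (\<lambda>x. indicator {y. 2 ^ k < y} (W x)))"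
    by (rule exp_sum)
  also have "\<dots> \<le> 1 + (\<Sum>k<K. 2 ^ k * (C / 2 ^ k))"
    by (intro add_left_mono sum_mono mult_left_mono ind) auto
  also have "\<dots> = 1 + C * K" by simp
  also have "\<dots> \<le> 1 + C * (1 + log 2 T)" using Kl C0 by (intro add_left_mono mult_left_mono) auto
  finally show "expectation (\<lambda>x. min (W x) T) \<le> 1 + C * (1 + log 2 T)" .
  have "expectation (\<lambda>x. (min (W x) T)\<^sup>2)
      \<le> expectation (\<lambda>x. 1 + (\<Sum>k<K. 3 * 4 ^ k * indicator {y. 2 ^ k < y} (W x)))"
  proof (intro integral_mono min_square_le_dyadic_sum TK W0)
    show "integrable M (\<lambda>x. (min (W x) T)\<^sup>2)"
      using W0 assms by (intro integrable_const_bound[of _ "T\<^sup>2"]) (auto intro!: AE_I2 power_mono)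
    show "integrable M (\<lambda>x. 1 + (\<Sum>k<K. 3 * 4 ^ k * indicator {y. 2 ^ k < y} (W x)) :: real)"
      by (rule int_sum)
  qed (use assms in auto)
  also have "\<dots> = 1 + (\<Sum>k<K. 3 * 4 ^ k * expectation (\<lambda>x. indicator {y. 2 ^ k < y} (W x)))"
    by (rule exp_sum)
  also have "\<dots> \<le> 1 + (\<Sum>k<K. 3 * 4 ^ k * (C / 2 ^ k))"
    by (intro add_left_mono sum_mono mult_left_mono ind) auto
  also have "(\<Sum>k<K. 3 * 4 ^ k * (C / 2 ^ k)) = 3 * C * (\<Sum>k<K. 2 ^ k)"
    unfolding sum_distrib_left
    by (intro sum.cong refl) (simp add: field_simps flip: power_mult_distrib)
  also have "(\<Sum>k<K. 2 ^ k :: real) = 2 ^ K - 1" by (simp add: sum_gp_strict field_simps)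
  also have "1 + 3 * C * (2 ^ K - 1) \<le> T + 3 * C * (2 * T)"
    using KT C0 assms by (intro add_mono mult_left_mono) auto
  finally show "expectation (\<lambda>x. (min (W x) T)\<^sup>2) \<le> (1 + 6 * C) * T" by (simp add: algebra_simps)
qed

section \<open>Lower bound on the truncated mean by cosine sums\<close>

lemma one_minus_cos_le:
  fixes w :: real
  shows "1 - cos w \<le> w\<^sup>2 / 2"
proof -
  have "cos w = 1 - 2 * (sin (w/2))\<^sup>2" using cos_double_sin[of "w/2"] by simp
  moreover have "(sin (w/2))\<^sup>2 \<le> (w/2)\<^sup>2"
    using abs_sin_x_le_abs_x[of "w/2"] by (simp only: abs_le_square_iff)
  ultimately show ?thesis by (simp add: power_divide)
qed

lemma one_minus_cos_le_2: "1 - cos w \<le> (2::real)"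
  using cos_ge_minus_one[of w] by linarith

lemma two_power_powr: "(2 ^ k :: real) powr p = (2 powr p) ^ k"
  by (simp add: powr_powr mult.commute flip: powr_realpow)

text \<open>A stand-in for \<open>min (\<bar>z\<bar> powr p) ((2 powr p) ^ K)\<close>, below it up
  to a constant factor, whose expectation is explicit. The weights undo the decay of
  \<open>1 - exp (- ((1 / 2 ^ k) powr p))\<close>, so that all scales contribute comparably.\<close>

definition cosine_sum :: "real \<Rightarrow> nat \<Rightarrow> real \<Rightarrow> real" where
  "cosine_sum p K z = (\<Sum>k\<le>K. (2 powr p) ^ k * (1 - cos (z / 2 ^ k)))"

text \<open>A geometric sum with ratio \<open>2 powr p >= 2\<close> is at most twice its last term;
  the other factor 2 in the 4 bounds \<open>1 - cos\<close>.\<close>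

lemma cosine_sum_le_const:
  assumes "1 \<le> p"
  shows "cosine_sum p K z \<le> 4 * (2 powr p) ^ K"
proof -
  have q: "2 \<le> 2 powr p" using powr_mono[of 1 p 2] assms by simp
  have "cosine_sum p K z \<le> (\<Sum>k\<le>K. (2 powr p) ^ k * 2)"
    unfolding cosine_sum_def
    by (intro sum_mono mult_left_mono) (simp_all add: one_minus_cos_le_2)
  also have "\<dots> \<le> 4 * (2 powr p) ^ K"
  proof (induction K)
    case (Suc K)
    have "2 * (2 powr p) ^ K \<le> 2 powr p * (2 powr p) ^ K" using q by (intro mult_right_mono) auto
    then show ?case unfolding sum.atMost_Suc power_Suc using Suc by linarith
  qed simp
  finally show ?thesis .
qed

text \<open>With \<open>2 ^ m\<close> the first power of 2 exceeding \<open>\<bar>z\<bar>\<close>, the terms below \<open>m\<close> are summed using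
  \<open>1 - cos w \<le> 2\<close> and the others using \<open>1 - cos w \<le> w\<^sup>2 / 2\<close>, which converges as \<open>p < 2\<close>.\<close>
lemma cosine_sum_le_powr:
  assumes "1 \<le> p" "p < 2"
  shows "cosine_sum p K z \<le> (2 * 2 powr p + 1 / (2 * (1 - 2 powr (p - 2)))) * \<bar>z\<bar> powr p"
proof -
  \<comment> \<open>\<open>\<theta> = q / 4\<close> is the ratio of the quadratic terms
    \<open>q ^ k * (z / 2 ^ k)\<^sup>2\<close>; \<open>p < 2\<close> puts it below 1.\<close>
  define q \<theta> where "q = 2 powr p" and "\<theta> = 2 powr (p - 2)"
  have q: "2 \<le> q" using powr_mono[of 1 p 2] assms by (simp add: q_def)
  have \<theta>: "0 < \<theta>" "\<theta> < 1" using assms powr_less_mono[of "p - 2" 0 2] by (auto simp: \<theta>_def)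
  have q\<theta>: "q / 4 = \<theta>" by (simp add: q_def \<theta>_def powr_diff)
  have "\<exists>m. \<bar>z\<bar> < 2 ^ m" by (rule real_arch_pow) simp
  define m where "m = (LEAST m. \<bar>z\<bar> < 2 ^ m)"
  have m: "\<bar>z\<bar> < 2 ^ m" unfolding m_def by (rule LeastI_ex) fact
  have geo: "(\<Sum>k<n. 2 * q ^ k) \<le> 2 * q ^ n" for n
  proof (induction n)
    case (Suc n)
    have "2 * q ^ n \<le> q * q ^ n" using q by (intro mult_right_mono) auto
    then show ?case using Suc by simp
  qed (use q in simp)
  have part1: "(\<Sum>k<m. q ^ k * (1 - cos (z / 2 ^ k))) \<le> 2 * q * \<bar>z\<bar> powr p"
  proof (cases m)
    case (Suc j)
    have "\<not> \<bar>z\<bar> < 2 ^ j" using Suc not_less_Least[of j "\<lambda>m. \<bar>z\<bar> < 2 ^ m"] unfolding m_def by auto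
    then have "(2 ^ j) powr p \<le> \<bar>z\<bar> powr p" using assms by (intro powr_mono2) auto
    then have qj: "q ^ j \<le> \<bar>z\<bar> powr p" by (simp add: q_def two_power_powr)
    have "(\<Sum>k<m. q ^ k * (1 - cos (z / 2 ^ k))) \<le> (\<Sum>k<m. q ^ k * 2)"
      by (intro sum_mono mult_left_mono) (use q in \<open>auto simp: one_minus_cos_le_2\<close>)
    also have "\<dots> \<le> 2 * q ^ m" using geo[of m] by (simp add: mult.commute)
    also have "\<dots> = 2 * q * q ^ j" using Suc by simp
    also have "\<dots> \<le> 2 * q * \<bar>z\<bar> powr p" using qj q by (intro mult_left_mono) auto
    finally show ?thesis .
  qed (use q in simp)
  \<comment> \<open>Since \<open>\<bar>z\<bar> < 2 ^ m\<close>, the surplus power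
    \<open>\<bar>z\<bar> powr (2 - p)\<close> is at most \<open>(2 powr (2 - p)) ^ m\<close>, the
    reciprocal of \<open>\<theta> ^ m\<close>.\<close>
  have z\<theta>: "z\<^sup>2 * \<theta> ^ m \<le> \<bar>z\<bar> powr p"
  proof (cases "z = 0")
    case False
    have "z\<^sup>2 = \<bar>z\<bar> powr 2" using False by simp
    also have "\<dots> = \<bar>z\<bar> powr p * \<bar>z\<bar> powr (2 - p)" using False by (simp flip: powr_add)
    finally have "z\<^sup>2 * \<theta> ^ m = \<bar>z\<bar> powr p * (\<bar>z\<bar> powr (2 - p) * \<theta> ^ m)" by simp
    also have "\<dots> \<le> \<bar>z\<bar> powr p * ((2 ^ m) powr (2 - p) * \<theta> ^ m)"
      using m \<theta> assms by (intro mult_right_mono mult_left_mono powr_mono2) auto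
    also have "(2 ^ m) powr (2 - p) * \<theta> ^ m = ((2 powr (2 - p)) * \<theta>) ^ m"
      by (simp add: two_power_powr power_mult_distrib)
    also have "2 powr (2 - p) * \<theta> = 1" by (simp add: \<theta>_def flip: powr_add)
    finally show ?thesis by simp
  qed simp
  have part2: "(\<Sum>k\<in>{m..K}. q ^ k * (1 - cos (z / 2 ^ k))) \<le> 1 / (2 * (1 - \<theta>)) * \<bar>z\<bar> powr p"
  proof -
    have "(\<Sum>k\<in>{m..K}. q ^ k * (1 - cos (z / 2 ^ k))) \<le> (\<Sum>k\<in>{m..K}. z\<^sup>2 / 2 * \<theta> ^ k)"
    proof (intro sum_mono)
      fix k
      have "q ^ k * (1 - cos (z / 2 ^ k)) \<le> q ^ k * ((z / 2 ^ k)\<^sup>2 / 2)"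
        using q by (intro mult_left_mono one_minus_cos_le) auto
      also have "\<dots> = z\<^sup>2 / 2 * (q / 4) ^ k"
        by (simp add: power_divide power2_eq_square flip: power_mult_distrib) (simp add: mult_ac)
      finally show "q ^ k * (1 - cos (z / 2 ^ k)) \<le> z\<^sup>2 / 2 * \<theta> ^ k" by (simp add: q\<theta>)
    qed
    also have "\<dots> = z\<^sup>2 / 2 * (\<Sum>k\<in>{m..K}. \<theta> ^ k)" by (simp add: sum_distrib_left)
    also have "\<dots> \<le> z\<^sup>2 / 2 * (\<theta> ^ m / (1 - \<theta>))"
      using \<theta> by (intro mult_left_mono) (auto simp: sum_gp divide_right_mono)
    also have "\<dots> = z\<^sup>2 * \<theta> ^ m * (1 / (2 * (1 - \<theta>)))" by simp
    also have "\<dots> \<le> \<bar>z\<bar> powr p * (1 / (2 * (1 - \<theta>)))"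
      using \<theta> z\<theta> by (intro mult_right_mono) auto
    finally show ?thesis by (simp add: mult.commute)
  qed
  \<comment> \<open>Only an inequality: if \<open>m\<close> exceeds \<open>Suc K\<close>, the right
    side has extra terms, all nonnegative.\<close>
  have "cosine_sum p K z \<le> (\<Sum>k\<in>{..<m} \<union> {m..K}. q ^ k * (1 - cos (z / 2 ^ k)))"
    unfolding cosine_sum_def q_def by (intro sum_mono2) auto
  also have "\<dots> = (\<Sum>k<m. q ^ k * (1 - cos (z / 2 ^ k))) + (\<Sum>k\<in>{m..K}. q ^ k * (1 - cos (z / 2 ^ k)))"
    by (intro sum.union_disjoint) auto
  also have "\<dots> \<le> 2 * q * \<bar>z\<bar> powr p + 1 / (2 * (1 - \<theta>)) * \<bar>z\<bar> powr p"
    by (intro add_mono part1 part2)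
  finally show ?thesis by (simp add: q_def \<theta>_def algebra_simps)
qed

lemma one_minus_exp_ge_half:
  fixes x :: real
  assumes "0 \<le> x" "x \<le> 1"
  shows "x / 2 \<le> 1 - exp (- x)"
proof -
  have "1 + x \<le> exp x" by (rule exp_ge_add_one_self)
  then have "exp (- x) \<le> 1 / (1 + x)" using assms by (simp add: exp_minus field_simps)
  also have "\<dots> \<le> 1 - x / 2"
  proof -
    have "x * x \<le> 1 * x" using assms by (intro mult_right_mono) auto
    then show ?thesis using assms by (simp add: field_simps)
  qed
  finally show ?thesis by simp
qed

text \<open>For \<open>x = (1 / 2 ^ k) powr p\<close> the weight is \<open>1 / x\<close>, and
  \<open>1 - exp (- x) >= x / 2\<close> on the unit interval, so every scale contributes at least
  1/2.\<close>

lemma stable_integral_cosine_sum: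
  assumes "std_sym_p_stable p D" "1 \<le> p"
  shows "integrable D (cosine_sum p K)" "real (Suc K) / 2 \<le> integral\<^sup>L D (cosine_sum p K)"
proof -
  note c = stable_integral_cos[OF assms(1), of "1 / 2 ^ k" for k, simplified]
  show "integrable D (cosine_sum p K)"
    unfolding cosine_sum_def[abs_def] using c by (intro Bochner_Integration.integrable_sum integrable_mult_right) auto
  have "integral\<^sup>L D (cosine_sum p K) = (\<Sum>k\<le>K. (2 powr p) ^ k * (1 - exp (- ((1 / 2 ^ k) powr p))))"
    unfolding cosine_sum_def[abs_def]
    by (subst Bochner_Integration.integral_sum) (auto simp: c intro!: integrable_mult_right c(1))
  also have "\<dots> \<ge> (\<Sum>k\<le>K. 1 / 2)"
  proof (intro sum_mono)
    fix k :: nat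
    define x where "x = (1 / 2 ^ k :: real) powr p"
    have q: "(2 powr p) ^ k * x = 1" by (simp add: x_def powr_divide two_power_powr)
    have "x \<le> 1 powr p" unfolding x_def using assms(2) by (intro powr_mono2) auto
    then have "x / 2 \<le> 1 - exp (- x)" by (intro one_minus_exp_ge_half) (auto simp: x_def)
    then have "(2 powr p) ^ k * (x / 2) \<le> (2 powr p) ^ k * (1 - exp (- x))"
      by (intro mult_left_mono) auto
    then show "1 / 2 \<le> (2 powr p) ^ k * (1 - exp (- ((1 / 2 ^ k) powr p)))"
      using q unfolding x_def[symmetric] by simp
  qed
  finally show "real (Suc K) / 2 \<le> integral\<^sup>L D (cosine_sum p K)" by simp
qed

lemma stable_truncated_moment_ge:
  assumes D: "std_sym_p_stable p D" and p: "1 \<le> p" "p < 2"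
    and C: "C = max 4 (2 * 2 powr p + 1 / (2 * (1 - 2 powr (p - 2))))"
    and T: "1 \<le> T"
  shows "ln T / (2 * C * p * ln 2) \<le> (\<integral>x. min (\<bar>x\<bar> powr p) T \<partial>D)"
proof -
  interpret real_distribution D using D by (simp add: std_sym_p_stable_def)
  define q where "q = 2 powr p"
  have q: "2 \<le> q" using powr_mono[of 1 p 2] p by (simp add: q_def)
  \<comment> \<open>Rounding down keeps \<open>q ^ K\<close> below the cap \<open>T\<close>, so the
    truncated power dominates \<open>cosine_sum\<close> up to \<open>C\<close>. Nothing is lost in
    the logarithm because \<open>cosine_sum\<close> has \<open>Suc K\<close> terms.\<close>
  define K where "K = nat \<lfloor>log q T\<rfloor>"
  have l0: "0 \<le> log q T" using T q by simp
  have K: "real K \<le> log q T" "log q T \<le> real (Suc K)" using l0 by (auto simp: K_def) linarith+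
  have "q ^ K = q powr K" using q by (simp add: powr_realpow)
  also have "\<dots> \<le> q powr (log q T)" using K q by (intro powr_mono) auto
  also have "\<dots> = T" using q T by simp
  finally have qK: "q ^ K \<le> T" .
  have C4: "4 \<le> C" by (simp add: C)
  have "log q T / 2 \<le> real (Suc K) / 2" using K by simp
  also have "\<dots> \<le> integral\<^sup>L D (cosine_sum p K)" by (rule stable_integral_cosine_sum[OF D p(1)])
  also have "\<dots> \<le> (\<integral>x. C * min (\<bar>x\<bar> powr p) T \<partial>D)"
  proof (intro integral_mono stable_integral_cosine_sum[OF D p(1)])
    show "integrable D (\<lambda>x. C * min (\<bar>x\<bar> powr p) T)"
      using T by (intro integrable_mult_right integrable_const_bound[of _ T]) (auto intro!: AE_I2)
    fix x
    have "cosine_sum p K x \<le> C * \<bar>x\<bar> powr p"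
      by (rule order_trans[OF cosine_sum_le_powr[OF p]]) (simp add: C mult_right_mono)
    moreover have "cosine_sum p K x \<le> C * T"
    proof -
      have "cosine_sum p K x \<le> 4 * q ^ K" unfolding q_def by (rule cosine_sum_le_const) (rule p)
      also have "\<dots> \<le> C * T" using C4 qK q by (intro mult_mono) auto
      finally show ?thesis .
    qed
    ultimately show "cosine_sum p K x \<le> C * min (\<bar>x\<bar> powr p) T" by (simp add: min_def)
  qed
  finally have "log q T / 2 \<le> C * (\<integral>x. min (\<bar>x\<bar> powr p) T \<partial>D)" by simp
  moreover have "log q T = ln T / (p * ln 2)" by (simp add: log_def q_def ln_powr)
  ultimately show ?thesis using C4 p by (simp add: field_simps)
qed

section \<open>Concentration for a single vector\<close>

text \<open>Independence removes the covariances of distinct terms; dropping the squared means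
  leaves the second moments, for which \<open>truncated_moments_le\<close> has a bound.\<close>

lemma (in prob_space) variance_sum_le:
  fixes Y :: "'i \<Rightarrow> 'a \<Rightarrow> real"
  assumes fin: "finite I" and ind: "indep_vars (\<lambda>_. borel) Y I"
    and sq: "\<And>i. i \<in> I \<Longrightarrow> integrable M (\<lambda>x. (Y i x)\<^sup>2)"
  shows "integrable M (\<lambda>x. (\<Sum>i\<in>I. Y i x)\<^sup>2)"
    and "variance (\<lambda>x. \<Sum>i\<in>I. Y i x) \<le> (\<Sum>i\<in>I. expectation (\<lambda>x. (Y i x)\<^sup>2))"
proof -
  have meas: "Y i \<in> borel_measurable M" if "i \<in> I" for i
    using ind that by (auto simp: indep_vars_def)
  have int: "integrable M (Y i)" if "i \<in> I" for i
    using square_integrable_imp_integrable meas sq that by blast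
  have prod: "integrable M (\<lambda>x. Y i x * Y j x) \<and>
      (i \<noteq> j \<longrightarrow> expectation (\<lambda>x. Y i x * Y j x) = expectation (Y i) * expectation (Y j))"
    if "i \<in> I" "j \<in> I" for i j
  proof (cases "i = j")
    case True
    then show ?thesis using sq that by (simp add: power2_eq_square)
  next
    case False
    have "indep_vars (\<lambda>_. borel) Y {i, j}" using indep_vars_subset[OF ind] that by simp
    then show ?thesis
      using False indep_vars_lebesgue_integral[of "{i, j}" Y] indep_vars_integrable[of "{i, j}" Y] int that
      by auto
  qed
  have eq: "(\<Sum>i\<in>I. Y i x)\<^sup>2 = (\<Sum>i\<in>I. \<Sum>j\<in>I. Y i x * Y j x)" for x
    by (simp add: power2_eq_square sum_product)
  show int2: "integrable M (\<lambda>x. (\<Sum>i\<in>I. Y i x)\<^sup>2)"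
    unfolding eq using prod by (intro Bochner_Integration.integrable_sum) auto
  have int1: "integrable M (\<lambda>x. \<Sum>i\<in>I. Y i x)"
    by (intro Bochner_Integration.integrable_sum int)
  have "variance (\<lambda>x. \<Sum>i\<in>I. Y i x)
      = expectation (\<lambda>x. (\<Sum>i\<in>I. Y i x)\<^sup>2) - (expectation (\<lambda>x. \<Sum>i\<in>I. Y i x))\<^sup>2"
    by (rule variance_eq[OF int1 int2])
  also have "(expectation (\<lambda>x. \<Sum>i\<in>I. Y i x))\<^sup>2 = (\<Sum>i\<in>I. expectation (Y i))\<^sup>2"
    using int by (subst Bochner_Integration.integral_sum) auto
  also have "expectation (\<lambda>x. (\<Sum>i\<in>I. Y i x)\<^sup>2) = (\<Sum>i\<in>I. \<Sum>j\<in>I. expectation (\<lambda>x. Y i x * Y j x))"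
    unfolding eq using prod
    by (subst Bochner_Integration.integral_sum)
      (auto intro!: Bochner_Integration.integrable_sum Bochner_Integration.integral_sum sum.cong)
  also have "\<dots> - (\<Sum>i\<in>I. expectation (Y i))\<^sup>2
      = (\<Sum>i\<in>I. \<Sum>j\<in>I. expectation (\<lambda>x. Y i x * Y j x) - expectation (Y i) * expectation (Y j))"
    by (simp add: power2_eq_square sum_product sum_subtractf)
  also have "\<dots> = (\<Sum>i\<in>I. expectation (\<lambda>x. Y i x * Y i x) - expectation (Y i) * expectation (Y i))"
  proof (intro sum.cong refl)
    fix i assume i: "i \<in> I"
    have "(\<Sum>j\<in>I. expectation (\<lambda>x. Y i x * Y j x) - expectation (Y i) * expectation (Y j))
       = (\<Sum>j\<in>I. if i = j then expectation (\<lambda>x. Y i x * Y i x) - expectation (Y i) * expectation (Y i) else 0)"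
      using prod i by (intro sum.cong) auto
    then show "(\<Sum>j\<in>I. expectation (\<lambda>x. Y i x * Y j x) - expectation (Y i) * expectation (Y j))
       = expectation (\<lambda>x. Y i x * Y i x) - expectation (Y i) * expectation (Y i)"
      using fin i by simp
  qed
  also have "\<dots> \<le> (\<Sum>i\<in>I. expectation (\<lambda>x. (Y i x)\<^sup>2))"
    by (intro sum_mono) (simp add: power2_eq_square)
  finally show "variance (\<lambda>x. \<Sum>i\<in>I. Y i x) \<le> (\<Sum>i\<in>I. expectation (\<lambda>x. (Y i x)\<^sup>2))" .
qed

text \<open>Chebyshev's inequality for the powers truncated at \<open>r * ln r\<close>; the truncation is inactive
  outside an event of probability \<open>O(1 / ln r)\<close>.\<close>
lemma stable_concentration:
  assumes p: "1 \<le> p" "p < 2"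
  shows "\<exists>\<alpha> \<beta> C. 0 < \<alpha> \<and> \<alpha> \<le> \<beta> \<and> 0 < C \<and>
    (\<forall>(M :: 'a measure) r Z. prob_space M \<longrightarrow> 3 \<le> r \<longrightarrow>
      prob_space.indep_vars M (\<lambda>_. borel) Z {..<r} \<longrightarrow>
      (\<forall>i<r. std_sym_p_stable p (distr M borel (Z i))) \<longrightarrow>
      1 - C / ln (real r) \<le> measure M {x \<in> space M.
        \<alpha> * (real r * ln (real r)) \<le> (\<Sum>i<r. \<bar>Z i x\<bar> powr p) \<and>
        (\<Sum>i<r. \<bar>Z i x\<bar> powr p) \<le> \<beta> * (real r * ln (real r))})"
proof -
  define C0 where "C0 = 2 / (1 - cos (1::real))"
  define C4 where "C4 = max 4 (2 * 2 powr p + 1 / (2 * (1 - 2 powr (p - 2))))"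
  define c where "c = 1 / (2 * C4 * p * ln 2)"
  \<comment> \<open>Comes from the upper bound \<open>1 + C0 * (1 + log 2 T)\<close> on the
    truncated mean with \<open>1 <= L\<close> and \<open>ln T <= 2 * L\<close>. In \<open>C\<close>
    the first summand pays for the truncation, the second for Chebyshev's inequality.\<close>
  define b where "b = 1 + C0 * (1 + 2 / ln 2)"
  define C where "C = C0 + 4 * (1 + 6 * C0) / c\<^sup>2"
  have C0: "0 < C0" unfolding C0_def using cos_monotone_0_pi[of 0 1] pi_gt3 by simp
  have c: "0 < c" unfolding c_def C4_def using p by (intro divide_pos_pos mult_pos_pos) auto
  have b: "0 < b" unfolding b_def using C0 by (intro add_pos_pos mult_pos_pos) auto
  have C: "0 < C" unfolding C_def using C0 c by (intro add_pos_pos divide_pos_pos mult_pos_pos) auto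
  have main: "1 - C / ln (real r) \<le> measure M {x \<in> space M.
        c / 2 * (real r * ln (real r)) \<le> (\<Sum>i<r. \<bar>Z i x\<bar> powr p) \<and>
        (\<Sum>i<r. \<bar>Z i x\<bar> powr p) \<le> (b + c / 2) * (real r * ln (real r))}"
    if M: "prob_space M" and r: "3 \<le> r" and ind: "prob_space.indep_vars M (\<lambda>_. borel) Z {..<r}"
      and st: "\<forall>i<r. std_sym_p_stable p (distr M borel (Z i))"
    for M :: "'a measure" and r Z
  proof -
    interpret prob_space M by fact
    define L where "L = ln (real r)"
    define T where "T = real r * L"
    define V where "V = (\<lambda>i x. min (\<bar>Z i x\<bar> powr p) T)"
    \<comment> \<open>Here \<open>3 <= r\<close> enters, as 3 is at least \<open>exp 1\<close>;
      additive constants can then be absorbed into multiples of \<open>L\<close>.\<close>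
    have L: "1 \<le> L"
    proof -
      have "exp 1 \<le> real r" using exp_le r by linarith
      then show ?thesis using r unfolding L_def by (subst ln_ge_iff) auto
    qed
    have rL: "L \<le> real r" using r ln_le_minus_one[of "real r"] by (simp add: L_def)
    have T: "1 \<le> T" "real r \<le> T" "T \<le> (real r)\<^sup>2"
      using L r rL mult_mono[of 1 "real r" 1 L] by (auto simp: T_def power2_eq_square)
    have lnT: "L \<le> ln T" "ln T \<le> 2 * L"
    proof -
      show "L \<le> ln T" using T r by (simp add: L_def)
      have "ln T \<le> ln ((real r)\<^sup>2)" using T r by (subst ln_le_cancel_iff) auto
      then show "ln T \<le> 2 * L" using r by (simp add: L_def ln_realpow)
    qed
    have Z: "Z i \<in> borel_measurable M" if "i < r" for i
      using ind that by (auto simp: indep_vars_def)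
    have tail: "prob {x \<in> space M. t < \<bar>Z i x\<bar> powr p} \<le> C0 / t" if "i < r" "1 \<le> t" for i t
    proof -
      have [measurable]: "Z i \<in> borel_measurable M" by (rule Z) fact
      have "(t < \<bar>z\<bar> powr p) = (t powr (1 / p) < \<bar>z\<bar>)" for z :: real
      proof -
        have "(t < \<bar>z\<bar> powr p) = ((t powr (1 / p)) powr p < \<bar>z\<bar> powr p)"
          using that p by (simp add: powr_powr)
        also have "\<dots> = (t powr (1 / p) < \<bar>z\<bar>)"
          using p powr_less_mono2[of p "t powr (1 / p)" "\<bar>z\<bar>"] powr_mono2[of p "\<bar>z\<bar>" "t powr (1 / p)"]
          by (auto simp: not_less[symmetric])
        finally show ?thesis .
      qed
      then have "prob {x \<in> space M. t < \<bar>Z i x\<bar> powr p} = measure (distr M borel (Z i)) {z. t powr (1 / p) < \<bar>z\<bar>}"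
        by (subst measure_distr) (auto intro!: arg_cong[where f=prob])
      also have "\<dots> \<le> C0 * (t powr (1 / p)) powr (- p)"
        unfolding C0_def using st that p by (intro stable_tail) auto
      also have "\<dots> = C0 / t" using that p by (simp add: powr_powr powr_minus divide_inverse)
      finally show ?thesis .
    qed
    have V: "V i \<in> borel_measurable M" if "i < r" for i
      using Z[OF that] unfolding V_def by measurable
    have V_bd: "0 \<le> V i x" "V i x \<le> T" for i x using T by (auto simp: V_def)
    have V_sq: "integrable M (\<lambda>x. (V i x)\<^sup>2)" if "i < r" for i
      using V[OF that] V_bd by (intro integrable_const_bound[of _ "T\<^sup>2"]) (auto intro!: AE_I2 power_mono)
    have V_int: "integrable M (V i)" if "i < r" for i
      using V[OF that] V_bd by (intro integrable_const_bound[of _ T]) (auto intro!: AE_I2)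
    have EV2: "expectation (\<lambda>x. (V i x)\<^sup>2) \<le> (1 + 6 * C0) * T"
      and EV_le: "expectation (V i) \<le> b * L" and EV_ge: "c * L \<le> expectation (V i)" if "i < r" for i
    proof -
      note [measurable] = Z[OF that]
      show "expectation (\<lambda>x. (V i x)\<^sup>2) \<le> (1 + 6 * C0) * T"
        unfolding V_def using T tail[OF that] by (intro truncated_moments_le) auto
      have "expectation (V i) \<le> 1 + C0 * (1 + log 2 T)"
        unfolding V_def using T tail[OF that] by (intro truncated_moments_le) auto
      also have "\<dots> \<le> L + C0 * (L + (2 * L) / ln 2)"
        using L lnT C0 by (intro add_mono mult_left_mono) (auto simp: log_def divide_right_mono)
      also have "\<dots> = b * L" by (simp add: b_def algebra_simps)
      finally show "expectation (V i) \<le> b * L" .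
      have "c * L \<le> c * ln T" using c lnT by simp
      also have "\<dots> = ln T / (2 * C4 * p * ln 2)" by (simp add: c_def)
      also have "\<dots> \<le> (\<integral>x. min (\<bar>x\<bar> powr p) T \<partial>distr M borel (Z i))"
        using st that T by (intro stable_truncated_moment_ge p) (auto simp: C4_def)
      also have "\<dots> = expectation (V i)" unfolding V_def by (subst integral_distr) auto
      finally show "c * L \<le> expectation (V i)" .
    qed
    have indV: "indep_vars (\<lambda>_. borel) V {..<r}"
      unfolding V_def by (rule indep_vars_compose2[OF ind]) auto
    define S where "S = (\<lambda>x. \<Sum>i<r. V i x)"
    have S_meas[measurable]: "S \<in> borel_measurable M" unfolding S_def using V by measurable
    have ES: "expectation S = (\<Sum>i<r. expectation (V i))"
      unfolding S_def using V_int by (intro Bochner_Integration.integral_sum) auto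
    have "expectation S \<le> (\<Sum>i<r. b * L)" unfolding ES using EV_le by (intro sum_mono) auto
    then have ES_le: "expectation S \<le> b * T" by (simp add: T_def mult_ac)
    have "(\<Sum>i<r. c * L) \<le> expectation S" unfolding ES using EV_ge by (intro sum_mono) auto
    then have ES_ge: "c * T \<le> expectation S" by (simp add: T_def mult_ac)
    have var: "variance S \<le> real r * ((1 + 6 * C0) * T)"
    proof -
      have "variance S \<le> (\<Sum>i<r. expectation (\<lambda>x. (V i x)\<^sup>2))"
        unfolding S_def by (intro variance_sum_le indV V_sq) auto
      also have "\<dots> \<le> (\<Sum>i<r. (1 + 6 * C0) * T)" using EV2 by (intro sum_mono) auto
      finally show ?thesis by simp
    qed
    \<comment> \<open>The allowed deviation is half of the lower bound \<open>c * T\<close> on the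
      mean, so off \<open>B1\<close> the truncated sum stays above \<open>c / 2 * T\<close>.
      \<open>B2\<close> is the event that truncation changes some term.\<close>
    define B1 where "B1 = {x \<in> space M. c / 2 * T \<le> \<bar>S x - expectation S\<bar>}"
    define B2 where "B2 = (\<Union>i<r. {x \<in> space M. T < \<bar>Z i x\<bar> powr p})"
    have B2s: "{x \<in> space M. T < \<bar>Z i x\<bar> powr p} \<in> events" if "i < r" for i
      using Z[OF that] by measurable
    have Bs: "B1 \<in> events" "B2 \<in> events" using B2s by (auto simp: B1_def B2_def)
    have "prob B1 \<le> variance S / (c / 2 * T)\<^sup>2"
      unfolding B1_def
    proof (rule Chebyshev_inequality)
      show "integrable M (\<lambda>x. (S x)\<^sup>2)"
        unfolding S_def using V_sq by (intro variance_sum_le indV) auto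
      show "0 < c / 2 * T" using c T by simp
    qed simp
    also have "\<dots> \<le> real r * ((1 + 6 * C0) * T) / (c / 2 * T)\<^sup>2"
      using var by (intro divide_right_mono) auto
    also have "\<dots> = 4 * (1 + 6 * C0) / c\<^sup>2 / L"
      using c T L r by (simp add: power2_eq_square T_def field_simps)
    finally have PB1: "prob B1 \<le> 4 * (1 + 6 * C0) / c\<^sup>2 / L" .
    have "prob B2 \<le> (\<Sum>i<r. prob {x \<in> space M. T < \<bar>Z i x\<bar> powr p})"
      unfolding B2_def using B2s by (intro finite_measure_subadditive_finite) auto
    also have "\<dots> \<le> (\<Sum>i<r. C0 / T)" using tail T by (intro sum_mono) auto
    also have "\<dots> = C0 / L" using r by (simp add: T_def)
    finally have PB2: "prob B2 \<le> C0 / L" .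
    have "prob (B1 \<union> B2) \<le> prob B1 + prob B2" using Bs by (rule measure_Un_le)
    also have "\<dots> \<le> C / L" using PB1 PB2 by (simp add: C_def add_divide_distrib)
    finally have "1 - C / L \<le> prob (space M - (B1 \<union> B2))" using Bs by (subst prob_compl) auto
    also have "\<dots> \<le> prob {x \<in> space M. c / 2 * T \<le> (\<Sum>i<r. \<bar>Z i x\<bar> powr p) \<and>
        (\<Sum>i<r. \<bar>Z i x\<bar> powr p) \<le> (b + c / 2) * T}"
    proof (intro finite_measure_mono subsetI)
      fix x assume x: "x \<in> space M - (B1 \<union> B2)"
      then have "\<bar>Z i x\<bar> powr p = V i x" if "i < r" for i
        using that by (force simp: B2_def V_def min_def)
      then have "(\<Sum>i<r. \<bar>Z i x\<bar> powr p) = S x" unfolding S_def by (intro sum.cong) auto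
      moreover have "\<bar>S x - expectation S\<bar> < c / 2 * T" using x by (auto simp: B1_def)
      moreover have "c / 2 * T \<le> s \<and> s \<le> (b + c / 2) * T" if "\<bar>s - expectation S\<bar> < c / 2 * T" for s
      proof -
        have "c * T = c / 2 * T + c / 2 * T" "(b + c / 2) * T = b * T + c / 2 * T"
          by (simp_all add: algebra_simps)
        then show ?thesis using that ES_le ES_ge by linarith
      qed
      ultimately show "x \<in> {x \<in> space M. c / 2 * T \<le> (\<Sum>i<r. \<bar>Z i x\<bar> powr p) \<and>
        (\<Sum>i<r. \<bar>Z i x\<bar> powr p) \<le> (b + c / 2) * T}"
        using x by auto
    next
      have [measurable]: "(\<lambda>x. \<Sum>i<r. \<bar>Z i x\<bar> powr p) \<in> borel_measurable M"
        using Z by (intro borel_measurable_sum) auto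
      show "{x \<in> space M. c / 2 * T \<le> (\<Sum>i<r. \<bar>Z i x\<bar> powr p) \<and>
        (\<Sum>i<r. \<bar>Z i x\<bar> powr p) \<le> (b + c / 2) * T} \<in> events" by measurable
    qed
    finally show ?thesis by (simp add: T_def L_def)
  qed
  show ?thesis
    using c b C main
    by (intro exI[of _ "c / 2"] exI[of _ "b + c / 2"] exI[of _ C] conjI allI impI) auto
qed

text \<open>In the characteristic function of the sum the exponents
  \<open>\<bar>t\<bar> powr p * \<bar>y j\<bar> powr p\<close> add up to
  \<open>\<bar>t\<bar> powr p\<close>, which is stability. Different \<open>i\<close> use disjoint
  rows of independent coordinates.\<close>

lemma std_sym_p_stable_combination:
  fixes D :: "real measure" and y :: "nat \<Rightarrow> real" and r n :: nat
  assumes D: "std_sym_p_stable p D" and y: "(\<Sum>j<n. \<bar>y j\<bar> powr p) = 1"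
  defines "P \<equiv> PiM ({..<r} \<times> {..<n}) (\<lambda>_. D)"
  shows "prob_space P"
    and "prob_space.indep_vars P (\<lambda>_. borel) (\<lambda>i X. \<Sum>j<n. X (i, j) * y j) {..<r}"
    and "i < r \<Longrightarrow> std_sym_p_stable p (distr P borel (\<lambda>X. \<Sum>j<n. X (i, j) * y j))"
proof -
  interpret D: real_distribution D using D by (simp add: std_sym_p_stable_def)
  let ?I = "{..<r} \<times> {..<n}"
  interpret PP: product_prob_space "\<lambda>_. D" ?I ..
  interpret P: prob_space P unfolding P_def by (rule PP.P.prob_space_axioms)
  show "prob_space P" by (rule P.prob_space_axioms)
  have coord_meas: "(\<lambda>X. X k) \<in> borel_measurable P" if "k \<in> ?I" for k
    using measurable_component_singleton[OF that, of "\<lambda>_. D"] by (simp add: P_def cong: measurable_cong_sets)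
  have coord_distr: "distr P borel (\<lambda>X. X k) = D" if "k \<in> ?I" for k
    using PP.PiM_component[OF that] by (simp add: P_def cong: distr_cong)
  have indI: "P.indep_vars (\<lambda>_. borel) (\<lambda>k X. X k) ?I"
  proof (cases "?I = {}")
    case True then show ?thesis unfolding True by (simp add: P.indep_vars_def P.indep_sets_def)
  next
    case False
    \<comment> \<open>On the product space restriction to the index set is the identity, so the
      joint law of the coordinates is the product measure itself. For a nonempty index set this
      characterises independence.\<close>
    have "distr P (PiM ?I (\<lambda>_. borel)) (\<lambda>x. \<lambda>i\<in>?I. x i) = distr P P (\<lambda>x. x)"
      unfolding P_def
      by (intro distr_cong sets_PiM_cong) (auto simp: space_PiM PiE_restrict)
    also have "\<dots> = PiM ?I (\<lambda>i. distr P borel (\<lambda>X. X i))"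
      by (subst distr_id2) (auto simp: P_def coord_distr[unfolded P_def] intro!: PiM_cong)
    finally show ?thesis
      using False coord_meas by (subst P.indep_vars_iff_distr_eq_PiM') auto
  qed
  have "P.indep_vars (\<lambda>i. PiM ({i} \<times> {..<n}) (\<lambda>_. borel)) (\<lambda>i X. restrict (\<lambda>k. X k) ({i} \<times> {..<n})) {..<r}"
    by (rule P.indep_vars_restrict[OF indI]) (auto simp: disjoint_family_on_def)
  then have "P.indep_vars (\<lambda>_. borel)
      (\<lambda>i X. (\<lambda>x. \<Sum>j<n. x (i, j) * y j) (restrict (\<lambda>k. X k) ({i} \<times> {..<n}))) {..<r}"
    by (rule P.indep_vars_compose2) auto
  then show "P.indep_vars (\<lambda>_. borel) (\<lambda>i X. \<Sum>j<n. X (i, j) * y j) {..<r}" by simp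
  assume i: "i < r"
  have "P.indep_vars (\<lambda>j. PiM {(i, j)} (\<lambda>_. borel)) (\<lambda>j X. restrict (\<lambda>k. X k) {(i, j)}) {..<n}"
    by (rule P.indep_vars_restrict[OF indI]) (use i in \<open>auto simp: disjoint_family_on_def\<close>)
  then have "P.indep_vars (\<lambda>_. borel) (\<lambda>j X. (\<lambda>x. x (i, j) * y j) (restrict (\<lambda>k. X k) {(i, j)})) {..<n}"
    by (rule P.indep_vars_compose2) auto
  then have ind: "P.indep_vars (\<lambda>_. borel) (\<lambda>j X. X (i, j) * y j) {..<n}" by simp
  have m: "(\<lambda>X. \<Sum>j<n. X (i, j) * y j) \<in> borel_measurable P"
    using coord_meas i by (intro borel_measurable_sum borel_measurable_times) auto
  have "char (distr P borel (\<lambda>X. \<Sum>j<n. X (i, j) * y j)) t = complex_of_real (exp (- (\<bar>t\<bar> powr p)))" for t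
  proof -
    have "char (distr P borel (\<lambda>X. \<Sum>j<n. X (i, j) * y j)) t
        = (\<Prod>j<n. char (distr P borel (\<lambda>X. X (i, j) * y j)) t)"
      by (rule P.char_distr_sum[OF ind])
    also have "\<dots> = (\<Prod>j<n. complex_of_real (exp (- (\<bar>t\<bar> powr p * \<bar>y j\<bar> powr p))))"
    proof (intro prod.cong refl)
      fix j assume "j \<in> {..<n}"
      then have ij: "(i, j) \<in> ?I" using i by simp
      have "char (distr P borel (\<lambda>X. X (i, j) * y j)) t = char (distr P borel (\<lambda>X. X (i, j))) (t * y j)"
        unfolding char_def using coord_meas[OF ij] by (subst (1 2) integral_distr) (auto simp: mult_ac)
      then show "char (distr P borel (\<lambda>X. X (i, j) * y j)) t = complex_of_real (exp (- (\<bar>t\<bar> powr p * \<bar>y j\<bar> powr p)))"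
        using D coord_distr[OF ij] by (simp add: std_sym_p_stable_def abs_mult powr_mult)
    qed
    also have "\<dots> = complex_of_real (exp (\<Sum>j<n. - (\<bar>t\<bar> powr p * \<bar>y j\<bar> powr p)))"
      by (simp add: exp_sum)
    also have "(\<Sum>j<n. - (\<bar>t\<bar> powr p * \<bar>y j\<bar> powr p)) = - (\<bar>t\<bar> powr p)"
      using y by (simp add: sum_negf flip: sum_distrib_left)
    finally show ?thesis .
  qed
  then show "std_sym_p_stable p (distr P borel (\<lambda>X. \<Sum>j<n. X (i, j) * y j))"
    using P.real_distribution_distr[OF m] by (simp add: std_sym_p_stable_def)
qed

section \<open>Seminorms and nets\<close>

lemma lp_norm_nonneg [simp]: "0 \<le> lp_norm p m v"
  by (simp add: lp_norm_def)

lemma lp_norm_powr: "1 \<le> p \<Longrightarrow> lp_norm p m v powr p = (\<Sum>i<m. \<bar>v i\<bar> powr p)"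
  by (simp add: lp_norm_def powr_powr sum_nonneg)

lemma lp_norm_cong: "(\<And>i. i < m \<Longrightarrow> v i = w i) \<Longrightarrow> lp_norm p m v = lp_norm p m w"
  by (simp add: lp_norm_def)

lemma lp_norm_eq_0_iff: "1 \<le> p \<Longrightarrow> lp_norm p m v = 0 \<longleftrightarrow> (\<forall>i<m. v i = 0)"
  by (auto simp: lp_norm_def sum_nonneg_eq_0_iff)

lemma lp_norm_scale:
  assumes "1 \<le> p"
  shows "lp_norm p m (\<lambda>i. t * v i) = \<bar>t\<bar> * lp_norm p m v"
proof -
  have "lp_norm p m (\<lambda>i. t * v i) = (\<bar>t\<bar> powr p * (\<Sum>i<m. \<bar>v i\<bar> powr p)) powr (1 / p)"
    by (simp add: lp_norm_def abs_mult powr_mult sum_distrib_left)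
  also have "\<dots> = \<bar>t\<bar> * lp_norm p m v"
    using assms by (simp add: powr_mult sum_nonneg powr_powr lp_norm_def)
  finally show ?thesis .
qed

text \<open>For positive arguments this is convexity of the power; if one of them is 0 it reduces to
  \<open>s powr p <= s\<close> for \<open>s\<close> in the unit interval.\<close>

lemma convex_powr_nonneg:
  fixes x y t p :: real
  assumes "1 \<le> p" "0 \<le> x" "0 \<le> y" "0 \<le> t" "t \<le> 1"
  shows "(t * x + (1 - t) * y) powr p \<le> t * x powr p + (1 - t) * y powr p"
proof -
  have *: "(s * z) powr p \<le> s * z powr p" if "0 \<le> s" "s \<le> 1" "0 \<le> z" for s z
  proof -
    have "s powr p \<le> s powr 1 \<or> s = 0" using that assms by (cases "s = 0") (use powr_mono'[of 1 p s] that assms in auto)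
    then have "s powr p \<le> s" using that by auto
    then show ?thesis using that by (simp add: powr_mult mult_right_mono)
  qed
  show ?thesis
  proof (cases "x = 0 \<or> y = 0")
    case True
    then show ?thesis using *[of t x] *[of "1 - t" y] assms by auto
  next
    case False
    have "convex_on {0<..} (\<lambda>x::real. x powr p)"
      using assms by (intro powr_convex) auto
    from convex_onD[OF this, of "1 - t" x y] show ?thesis
      using False assms by (simp add: algebra_simps)
  qed
qed

text \<open>By convexity of \<open>t powr p\<close>, applied to the normalised vectors.\<close>
lemma lp_norm_triangle:
  assumes p: "1 \<le> p"
  shows "lp_norm p m (\<lambda>i. u i + v i) \<le> lp_norm p m u + lp_norm p m v"
proof (cases "lp_norm p m u = 0 \<or> lp_norm p m v = 0")
  case True
  then show ?thesis
  proof
    assume "lp_norm p m u = 0"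
    then have "lp_norm p m (\<lambda>i. u i + v i) = lp_norm p m v"
      using p by (intro lp_norm_cong) (simp add: lp_norm_eq_0_iff)
    then show ?thesis by simp
  next
    assume "lp_norm p m v = 0"
    then have "lp_norm p m (\<lambda>i. u i + v i) = lp_norm p m u"
      using p by (intro lp_norm_cong) (simp add: lp_norm_eq_0_iff)
    then show ?thesis by simp
  qed
next
  case False
  define a b where "a = lp_norm p m u" and "b = lp_norm p m v"
  have ab: "0 < a" "0 < b" using False lp_norm_nonneg[of p m] by (auto simp: a_def b_def less_le)
  \<comment> \<open>The weight that makes
    \<open>(\<bar>u i\<bar> + \<bar>v i\<bar>) / (a + b)\<close> a convex combination of
    \<open>\<bar>u i\<bar> / a\<close> and \<open>\<bar>v i\<bar> / b\<close>.\<close>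
  define t where "t = a / (a + b)"
  have t: "0 \<le> t" "t \<le> 1" "1 - t = b / (a + b)" using ab by (auto simp: t_def field_simps)
  have sums: "(\<Sum>i<m. (\<bar>u i\<bar> / a) powr p) = 1" "(\<Sum>i<m. (\<bar>v i\<bar> / b) powr p) = 1"
    using ab lp_norm_powr[OF p, of m u] lp_norm_powr[OF p, of m v]
    by (auto simp: powr_divide a_def b_def simp flip: sum_divide_distrib)
  have "(\<Sum>i<m. \<bar>u i + v i\<bar> powr p) \<le> (\<Sum>i<m. (a + b) powr p * (t * (\<bar>u i\<bar> / a) powr p + (1 - t) * (\<bar>v i\<bar> / b) powr p))"
  proof (intro sum_mono)
    fix i
    have "\<bar>u i + v i\<bar> powr p \<le> (\<bar>u i\<bar> + \<bar>v i\<bar>) powr p" using p by (intro powr_mono2) auto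
    also have "\<bar>u i\<bar> + \<bar>v i\<bar> = (a + b) * (t * (\<bar>u i\<bar> / a) + (1 - t) * (\<bar>v i\<bar> / b))"
      unfolding t(3) using ab by (simp add: t_def distrib_left)
    also have "\<dots> powr p = (a + b) powr p * (t * (\<bar>u i\<bar> / a) + (1 - t) * (\<bar>v i\<bar> / b)) powr p"
      using ab t by (subst powr_mult) auto
    also have "\<dots> \<le> (a + b) powr p * (t * (\<bar>u i\<bar> / a) powr p + (1 - t) * (\<bar>v i\<bar> / b) powr p)"
      using ab t p by (intro mult_left_mono convex_powr_nonneg) auto
    finally show "\<bar>u i + v i\<bar> powr p \<le> (a + b) powr p * (t * (\<bar>u i\<bar> / a) powr p + (1 - t) * (\<bar>v i\<bar> / b) powr p)" .
  qed
  also have "\<dots> = (a + b) powr p * (t * (\<Sum>i<m. (\<bar>u i\<bar> / a) powr p) + (1 - t) * (\<Sum>i<m. (\<bar>v i\<bar> / b) powr p))"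
    by (simp add: sum.distrib flip: sum_distrib_left)
  also have "\<dots> = (a + b) powr p" by (simp add: sums)
  finally have "(\<Sum>i<m. \<bar>u i + v i\<bar> powr p) powr (1 / p) \<le> ((a + b) powr p) powr (1 / p)"
    using p by (intro powr_mono2) (auto intro: sum_nonneg)
  then show ?thesis using p ab by (simp add: powr_powr lp_norm_def a_def b_def)
qed

section \<open>Seminorms on coordinate space and nets from lattice points\<close>

lemma card_bounded_integer_vectors:
  "card (PiE {..<d} (\<lambda>_. {- int k..int k})) = (2 * k + 1) ^ d"
proof -
  have "nat (2 * int k + 1) = 2 * k + 1" by (simp add: nat_add_distrib nat_mult_distrib)
  then show ?thesis by (simp add: card_PiE)
qed

text \<open>Seminorms on \<open>\<real>\<^sup>d\<close>, presented on functions \<open>nat \<Rightarrow> real\<close> of which only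
  the values below \<open>d\<close> matter.\<close>
locale coord_seminorm =
  fixes d :: nat and q :: "(nat \<Rightarrow> real) \<Rightarrow> real"
  assumes q_cong: "(\<And>j. j < d \<Longrightarrow> x j = y j) \<Longrightarrow> q x = q y"
    and q_triangle: "q (\<lambda>j. x j + y j) \<le> q x + q y"
    and q_scale: "q (\<lambda>j. t * x j) = \<bar>t\<bar> * q x"
begin

lemma q_zero: "q (\<lambda>_. 0) = 0"
  using q_scale[of 0] by simp

lemma q_nonneg: "0 \<le> q x"
  using q_triangle[of x "\<lambda>j. - 1 * x j"] q_scale[of "- 1" x] q_zero by simp

lemma q_diff_commute: "q (\<lambda>j. x j - y j) = q (\<lambda>j. y j - x j)"
  using q_scale[of "-1" "\<lambda>j. y j - x j"] by (simp add: algebra_simps)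

lemma q_diff_triangle: "q (\<lambda>j. x j - z j) \<le> q (\<lambda>j. x j - y j) + q (\<lambda>j. y j - z j)"
  using q_triangle[of "\<lambda>j. x j - y j" "\<lambda>j. y j - z j"] by simp

lemma q_le_add_diff: "q x \<le> q y + q (\<lambda>j. x j - y j)"
  using q_triangle[of y "\<lambda>j. x j - y j"] by simp

text \<open>This domination provides continuity, the cost of rounding to lattice points, and the
  crude bound that starts the iteration in \<open>net_comparison\<close>.\<close>

lemma q_le_coords: "q x \<le> (\<Sum>k<d. \<bar>x k\<bar> * q (\<lambda>j. if j = k then 1 else 0))"
proof -
  have "q (\<lambda>j. if j < m then x j else 0) \<le> (\<Sum>k<m. \<bar>x k\<bar> * q (\<lambda>j. if j = k then 1 else 0))" for m
  proof (induction m)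
    case 0
    then show ?case using q_zero by simp
  next
    case (Suc m)
    have "q (\<lambda>j. if j < Suc m then x j else 0)
        = q (\<lambda>j. (if j < m then x j else 0) + x m * (if j = m then 1 else 0))"
      by (intro arg_cong[where f=q]) (auto simp: fun_eq_iff less_Suc_eq)
    also have "\<dots> \<le> q (\<lambda>j. if j < m then x j else 0) + \<bar>x m\<bar> * q (\<lambda>j. if j = m then 1 else 0)"
      using q_triangle[of "\<lambda>j. if j < m then x j else 0" "\<lambda>j. x m * (if j = m then 1 else 0)"]
      unfolding q_scale .
    finally show ?case using Suc by simp
  qed
  from this[of d] show ?thesis using q_cong[of "\<lambda>j. if j < d then x j else 0" x] by simp
qed

lemma q_tendsto:
  assumes "\<And>k. k < d \<Longrightarrow> (\<lambda>m. y m k) \<longlonglongrightarrow> x k"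
  shows "(\<lambda>m. q (y m)) \<longlonglongrightarrow> q x"
proof (rule LIM_zero_cancel, rule tendsto_0_le[where K = 1])
  show "(\<lambda>m. \<Sum>k<d. \<bar>y m k - x k\<bar> * q (\<lambda>j. if j = k then 1 else 0)) \<longlonglongrightarrow> 0"
    using assms by (intro tendsto_null_sum tendsto_mult_left_zero) (auto simp: LIM_zero_iff tendsto_rabs_zero_iff)
  have "\<bar>q (y m) - q x\<bar> \<le> q (\<lambda>j. y m j - x j)" for m
    using q_le_add_diff[of "y m" x] q_le_add_diff[of x "y m"] q_diff_commute[of x "y m"] by simp
  also have "\<dots> m \<le> (\<Sum>k<d. \<bar>y m k - x k\<bar> * q (\<lambda>j. if j = k then 1 else 0))" for m
    by (rule q_le_coords)
  finally show "\<forall>\<^sub>F m in sequentially. norm (q (y m) - q x)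
      \<le> norm (\<Sum>k<d. \<bar>y m k - x k\<bar> * q (\<lambda>j. if j = k then 1 else 0)) * 1"
    by (intro always_eventually allI) (auto intro: order_trans[OF _ abs_ge_self])
qed

end

text \<open>\<open>coord_le\<close> is definiteness in quantitative form. \<open>M\<close> may be
  huge: it controls the growth of lattice counts and a starting error that is iterated away, and
  enters no final constant.\<close>

locale coord_norm = coord_seminorm +
  fixes M :: real
  assumes coord_le: "j < d \<Longrightarrow> \<bar>x j\<bar> \<le> M * q x"
    and M_pos: "0 < M"
    and d_pos: "0 < d"
begin

text \<open>\<open>PiE\<close> pins the values from \<open>d\<close> on to \<open>undefined\<close>,
  so that every integer point is counted once and the set is finite.\<close>

definition lattice_ball :: "real \<Rightarrow> (nat \<Rightarrow> int) set" where
  "lattice_ball R = {z \<in> PiE {..<d} (\<lambda>_. UNIV). q (\<lambda>j. real_of_int (z j)) \<le> R}"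

lemma lattice_ball_subset:
  assumes "0 \<le> R"
  shows "lattice_ball R \<subseteq> PiE {..<d} (\<lambda>_. {- int (nat \<lfloor>M * R\<rfloor>)..int (nat \<lfloor>M * R\<rfloor>)})"
proof (intro subsetI PiE_I)
  fix z j assume z: "z \<in> lattice_ball R" and "j \<in> {..<d}"
  then have "\<bar>real_of_int (z j)\<bar> \<le> M * q (\<lambda>j. real_of_int (z j))" by (intro coord_le) simp
  also have "\<dots> \<le> M * R" using z M_pos by (simp add: lattice_ball_def)
  finally have "\<bar>z j\<bar> \<le> \<lfloor>M * R\<rfloor>" by (simp add: le_floor_iff)
  moreover have "0 \<le> \<lfloor>M * R\<rfloor>" using M_pos assms by simp
  ultimately show "z j \<in> {- int (nat \<lfloor>M * R\<rfloor>)..int (nat \<lfloor>M * R\<rfloor>)}" by auto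
qed (auto simp: lattice_ball_def PiE_def extensional_def)

lemma finite_lattice_ball: "finite (lattice_ball R)"
proof (cases "0 \<le> R")
  case True
  show ?thesis by (rule finite_subset[OF lattice_ball_subset[OF True]]) (auto intro: finite_PiE)
next
  case False
  then have "lattice_ball R = {}" using q_nonneg by (auto simp: lattice_ball_def dest: order_trans)
  then show ?thesis by simp
qed

lemma card_lattice_ball_le:
  assumes "0 \<le> R"
  shows "real (card (lattice_ball R)) \<le> (2 * M * R + 1) ^ d"
proof -
  have MR: "0 \<le> M * R" using assms M_pos by simp
  have "card (lattice_ball R) \<le> (2 * nat \<lfloor>M * R\<rfloor> + 1) ^ d"
    using card_mono[OF _ lattice_ball_subset[OF assms]]
    unfolding card_bounded_integer_vectors by (auto intro: finite_PiE)
  then have "real (card (lattice_ball R)) \<le> (2 * real (nat \<lfloor>M * R\<rfloor>) + 1) ^ d"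
    by (metis (mono_tags, lifting) of_nat_1 of_nat_add of_nat_le_iff of_nat_mult of_nat_numeral of_nat_power)
  also have "\<dots> \<le> (2 * M * R + 1) ^ d"
    using MR of_nat_floor[OF MR] by (intro power_mono) auto
  finally show ?thesis .
qed

lemma card_lattice_ball_pos: "0 \<le> R \<Longrightarrow> 1 \<le> card (lattice_ball R)"
proof -
  assume "0 \<le> R"
  have "restrict (\<lambda>_. 0) {..<d} \<in> lattice_ball R"
    using \<open>0 \<le> R\<close> q_zero q_cong[of "\<lambda>j. real_of_int (restrict (\<lambda>_. 0) {..<d} j)" "\<lambda>_. 0"]
    by (simp add: lattice_ball_def)
  then show ?thesis using finite_lattice_ball by (metis One_nat_def Suc_leI card_gt_0_iff empty_iff)
qed

text \<open>Polynomial growth forces a scale at which the number of lattice points in a ball grows no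
  faster than volume would, up to a factor \<open>2 ^ d\<close>.\<close>
lemma ex_doubling_scale:
  assumes "0 < R0" "1 \<le> l"
  obtains R where "R0 \<le> R" "real (card (lattice_ball (l * R))) \<le> (2 * l) ^ d * real (card (lattice_ball R))"
proof (rule ccontr)
  assume "\<not> thesis"
  with that have big: "(2 * l) ^ d * real (card (lattice_ball R)) < real (card (lattice_ball (l * R)))"
    if "R0 \<le> R" for R using \<open>R0 \<le> R\<close> not_le by blast
  \<comment> \<open>Iterating the assumed growth yields \<open>(2 * l) ^ (d * k)\<close> points at
    radius \<open>l ^ k * R0\<close>. Polynomial growth allows only \<open>(l ^ k * K) ^ d\<close>,
    so after \<open>d\<close>-th roots the spare factor 2 forces \<open>2 ^ k <= K\<close> for every
    \<open>k\<close>.\<close>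
  have low: "((2 * l) ^ d) ^ k \<le> real (card (lattice_ball (l ^ k * R0)))" for k
  proof (induction k)
    case 0
    then show ?case using card_lattice_ball_pos[of R0] assms by simp
  next
    case (Suc k)
    have "R0 \<le> l ^ k * R0" using assms by simp
    from big[OF this] have "(2 * l) ^ d * real (card (lattice_ball (l ^ k * R0))) < real (card (lattice_ball (l ^ Suc k * R0)))"
      by (simp add: mult_ac)
    moreover have "(2 * l) ^ d * ((2 * l) ^ d) ^ k \<le> (2 * l) ^ d * real (card (lattice_ball (l ^ k * R0)))"
      using Suc assms by (intro mult_left_mono) auto
    ultimately have "(2 * l) ^ d * ((2 * l) ^ d) ^ k \<le> real (card (lattice_ball (l ^ Suc k * R0)))"
      by linarith
    then show ?case by (simp only: power_Suc)
  qed
  define K where "K = 2 * M * R0 + 1"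
  have K: "0 < K" using assms M_pos by (simp add: K_def add_pos_pos)
  obtain k where k: "K < 2 ^ k" using real_arch_pow[of 2 K] by auto
  have "((2 * l) ^ k) ^ d = ((2 * l) ^ d) ^ k" by (metis mult.commute power_mult)
  also note low[of k]
  also have "real (card (lattice_ball (l ^ k * R0))) \<le> (2 * M * (l ^ k * R0) + 1) ^ d"
    using assms by (intro card_lattice_ball_le) auto
  also have "\<dots> \<le> (l ^ k * K) ^ d"
    using assms M_pos by (intro power_mono) (auto simp: K_def algebra_simps)
  finally have "(2 * l) ^ k \<le> l ^ k * K"
    using assms K d_pos by (subst (asm) power_mono_iff) auto
  then have "2 ^ k \<le> K" using assms by (simp add: power_mult_distrib)
  then show False using k by simp
qed

text \<open>A maximal separated set of lattice points in a large ball, rescaled. The packing bound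
  compares numbers of lattice points instead of volumes.\<close>
lemma ex_net:
  assumes \<epsilon>: "0 < \<epsilon>" "\<epsilon> \<le> 1"
  shows "\<exists>N. finite N \<and> real (card N) \<le> (16 / \<epsilon>) ^ d \<and> (\<forall>u\<in>N. q u \<le> 1) \<and>
    (\<forall>x. q x \<le> 1 \<longrightarrow> (\<exists>u\<in>N. q (\<lambda>j. x j - u j) \<le> \<epsilon>))"
proof -
  \<comment> \<open>The price of rounding: moving every coordinate by at most 1 changes
    \<open>q\<close> by at most this much.\<close>
  define \<rho> where "\<rho> = (\<Sum>k<d. q (\<lambda>j. if j = k then 1 else 0))"
  have \<rho>: "0 \<le> \<rho>" unfolding \<rho>_def by (intro sum_nonneg q_nonneg)
  \<comment> \<open>Half of \<open>\<epsilon>\<close> is spent on separation, half on rounding twice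
    \<open>\<rho>\<close>. The packing radius is \<open>R' = \<epsilon>' * R / 2\<close>, and
    \<open>l\<close> is chosen so that \<open>l * R' = 2 * R\<close>, a radius containing all sums
    of a point of the large ball and one of the packing ball. This yields
    \<open>2 * l = 16 / \<epsilon>\<close>.\<close>
  define \<epsilon>' where "\<epsilon>' = \<epsilon> / 2"
  define l where "l = 4 / \<epsilon>'"
  have l: "1 \<le> l" using \<epsilon> by (simp add: l_def \<epsilon>'_def field_simps)
  obtain R' where R': "\<rho> + 1 \<le> R'"
    and dbl: "real (card (lattice_ball (l * R'))) \<le> (2 * l) ^ d * real (card (lattice_ball R'))"
    using ex_doubling_scale[of "\<rho> + 1" l] l \<rho> by (auto simp: add_nonneg_pos)
  define R where "R = 2 * R' / \<epsilon>'"
  have R: "0 < R" "R' = \<epsilon>' * R / 2" "l * R' = 2 * R" "4 * \<rho> \<le> \<epsilon> * R"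
    using R' \<rho> \<epsilon> by (auto simp: R_def l_def \<epsilon>'_def field_simps)
  let ?r = "\<lambda>z j. real_of_int (z j)"
  define sep where "sep Y \<longleftrightarrow> Y \<subseteq> lattice_ball R \<and>
    (\<forall>y\<in>Y. \<forall>y'\<in>Y. y \<noteq> y' \<longrightarrow> \<epsilon>' * R < q (\<lambda>j. ?r y j - ?r y' j))" for Y
  have sep_fin: "finite Y" "card Y \<le> card (lattice_ball R)" if "sep Y" for Y
    using that finite_lattice_ball[of R] by (auto simp: sep_def intro: finite_subset card_mono)
  have "sep {}" by (simp add: sep_def)
  from ex_has_greatest_nat[of sep, OF this, of card "Suc (card (lattice_ball R))"]
  obtain Y where Y: "sep Y" and max: "\<And>Y'. sep Y' \<Longrightarrow> card Y' \<le> card Y"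
    using sep_fin by (auto simp: less_Suc_eq_le)
  have cover: "\<exists>y\<in>Y. q (\<lambda>j. ?r z j - ?r y j) \<le> \<epsilon>' * R" if z: "z \<in> lattice_ball R" for z
  proof (rule ccontr)
    assume "\<not> ?thesis"
    then have far: "\<epsilon>' * R < q (\<lambda>j. ?r z j - ?r y j)" if "y \<in> Y" for y
      using that not_le by blast
    have "z \<notin> Y" using far[of z] q_zero \<epsilon> R by (auto simp: \<epsilon>'_def mult_less_0_iff)
    moreover have "sep (insert z Y)"
      using Y z far q_diff_commute[of "?r z"] by (auto simp: sep_def)
    ultimately show False using max[of "insert z Y"] sep_fin[OF Y] by simp
  qed
  define add where "add y z = restrict (\<lambda>j. y j + z j) {..<d}" for y z :: "nat \<Rightarrow> int"
  have q_add: "q (?r (add y z)) = q (\<lambda>j. ?r y j + ?r z j)" for y z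
    by (rule q_cong) (simp add: add_def)
  \<comment> \<open>Injectivity of addition expresses that the packing balls around points of
    \<open>Y\<close> are disjoint: if two met, their centres would be within
    \<open>2 * R' = \<epsilon>' * R\<close>, against the strict separation.\<close>
  have disj: "inj_on (\<lambda>(y, z). add y z) (Y \<times> lattice_ball R')"
  proof (intro inj_onI; clarify)
    fix y z y' z' assume *: "y \<in> Y" "y' \<in> Y" "z \<in> lattice_ball R'" "z' \<in> lattice_ball R'" "add y z = add y' z'"
    have eq: "y j + z j = y' j + z' j" if "j < d" for j
      using fun_cong[OF *(5), of j] that by (simp add: add_def)
    have "q (\<lambda>j. ?r y j - ?r y' j) = q (\<lambda>j. ?r z' j - ?r z j)"
    proof (rule q_cong)
      fix j assume "j < d"
      then have "?r y j + ?r z j = ?r y' j + ?r z' j" using eq[of j] by (metis of_int_add)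
      then show "?r y j - ?r y' j = ?r z' j - ?r z j" by simp
    qed
    also have "\<dots> \<le> q (?r z') + q (\<lambda>j. - ?r z j)"
      using q_triangle[of "?r z'" "\<lambda>j. - ?r z j"] by simp
    also have "\<dots> \<le> R' + R'"
      using * q_scale[of "-1" "?r z"] by (auto simp: lattice_ball_def)
    also have "\<dots> = \<epsilon>' * R" using R by simp
    finally have "y = y'" using Y * unfolding sep_def by (metis not_le)
    moreover have "z = z'"
    proof
      show "z j = z' j" for j
        using eq[of j] \<open>y = y'\<close> * by (cases "j < d") (auto simp: lattice_ball_def PiE_def extensional_def)
    qed
    ultimately show "y = y' \<and> z = z'" by simp
  qed
  have "(\<lambda>(y, z). add y z) ` (Y \<times> lattice_ball R') \<subseteq> lattice_ball (l * R')"
  proof clarify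
    fix y z assume yz: "y \<in> Y" "z \<in> lattice_ball R'"
    have "q (?r (add y z)) \<le> q (?r y) + q (?r z)" unfolding q_add by (rule q_triangle)
    also have "\<dots> \<le> R + R'" using yz Y by (intro add_mono) (auto simp: sep_def lattice_ball_def)
    also have "\<dots> \<le> l * R'"
    proof -
      have "R' \<le> R" using R(1) \<epsilon> unfolding R(2) \<epsilon>'_def by (simp add: mult_le_cancel_right)
      then show ?thesis using R(3) by simp
    qed
    finally show "add y z \<in> lattice_ball (l * R')" by (simp add: lattice_ball_def add_def)
  qed
  from card_mono[OF finite_lattice_ball this]
  have "card Y * card (lattice_ball R') \<le> card (lattice_ball (l * R'))"
    by (simp add: card_image[OF disj] card_cartesian_product)
  then have "real (card Y) * real (card (lattice_ball R')) \<le> real (card (lattice_ball (l * R')))"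
    by (simp flip: of_nat_mult)
  also note dbl
  finally have cardY: "real (card Y) \<le> (2 * l) ^ d"
    using card_lattice_ball_pos[of R'] R' \<rho> by (simp add: mult_le_cancel_right)
  define N where "N = (\<lambda>y j. ?r y j / R) ` Y"
  show ?thesis
  proof (intro exI[of _ N] conjI ballI allI impI)
    show "finite N" using sep_fin[OF Y] by (simp add: N_def)
    have "real (card N) \<le> real (card Y)" unfolding N_def using sep_fin[OF Y] by (simp add: card_image_le)
    also note cardY
    also have "2 * l = 16 / \<epsilon>" by (simp add: l_def \<epsilon>'_def)
    finally show "real (card N) \<le> (16 / \<epsilon>) ^ d" .
  next
    fix u assume "u \<in> N"
    then obtain y where y: "y \<in> Y" "u = (\<lambda>j. ?r y j / R)" by (auto simp: N_def)
    then show "q u \<le> 1"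
      using q_scale[of "1 / R" "?r y"] R Y by (auto simp: sep_def lattice_ball_def subset_iff)
  next
    fix x assume x: "q x \<le> 1"
    \<comment> \<open>Shrinking by \<open>\<rho>\<close> before rounding keeps the rounded point
      \<open>z\<close> in the ball of radius \<open>R\<close>; it costs one more
      \<open>\<rho>\<close> in the distance.\<close>
    define s where "s = R - \<rho>"
    have s: "0 \<le> s" "s \<le> R"
    proof -
      have "\<epsilon> * R \<le> 1 * R" using \<epsilon> R(1) by (intro mult_right_mono) auto
      then show "0 \<le> s" "s \<le> R" using R(4) \<rho> by (auto simp: s_def)
    qed
    define z where "z = restrict (\<lambda>j. \<lfloor>s * x j\<rfloor>) {..<d}"
    have "q (\<lambda>j. ?r z j - s * x j) \<le> (\<Sum>k<d. \<bar>?r z k - s * x k\<bar> * q (\<lambda>j. if j = k then 1 else 0))"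
      by (rule q_le_coords)
    also have "\<dots> \<le> (\<Sum>k<d. 1 * q (\<lambda>j. if j = k then 1 else 0))"
    proof (intro sum_mono mult_right_mono q_nonneg)
      fix k assume "k \<in> {..<d}"
      then have "z k = \<lfloor>s * x k\<rfloor>" by (simp add: z_def)
      then show "\<bar>?r z k - s * x k\<bar> \<le> 1" by linarith
    qed
    finally have round: "q (\<lambda>j. ?r z j - s * x j) \<le> \<rho>" by (simp add: \<rho>_def)
    have "q (?r z) \<le> q (\<lambda>j. ?r z j - s * x j) + q (\<lambda>j. s * x j)"
      using q_triangle[of "\<lambda>j. ?r z j - s * x j" "\<lambda>j. s * x j"] by simp
    also have "\<dots> \<le> \<rho> + s"
      using round q_scale[of s x] x s mult_left_mono[of "q x" 1 s] by simp
    finally have "z \<in> lattice_ball R" by (simp add: s_def lattice_ball_def z_def)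
    from cover[OF this] obtain y where y: "y \<in> Y" "q (\<lambda>j. ?r z j - ?r y j) \<le> \<epsilon>' * R" by blast
    have "q (\<lambda>j. R * x j - ?r y j) \<le> q (\<lambda>j. R * x j - ?r z j) + q (\<lambda>j. ?r z j - ?r y j)"
      by (rule q_diff_triangle)
    also have "q (\<lambda>j. R * x j - ?r z j) \<le> q (\<lambda>j. R * x j - s * x j) + q (\<lambda>j. s * x j - ?r z j)"
      by (rule q_diff_triangle)
    also have "q (\<lambda>j. R * x j - s * x j) = \<rho> * q x"
      using q_scale[of \<rho> x] \<rho> by (simp add: s_def algebra_simps)
    also have "\<rho> * q x \<le> \<rho>" using x \<rho> mult_left_mono[of "q x" 1 \<rho>] by simp
    also have "q (\<lambda>j. s * x j - ?r z j) \<le> \<rho>" using round q_diff_commute[of "?r z"] by simp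
    finally have "q (\<lambda>j. R * x j - ?r y j) \<le> \<rho> + \<rho> + \<epsilon>' * R" using y by simp
    also have "\<dots> \<le> \<epsilon> * R" using R(4) by (simp add: \<epsilon>'_def)
    finally have bd: "q (\<lambda>j. R * x j - ?r y j) \<le> \<epsilon> * R" .
    have "(\<lambda>j. x j - ?r y j / R) = (\<lambda>j. (1 / R) * (R * x j - ?r y j))"
      using R by (simp add: fun_eq_iff field_simps)
    then have "q (\<lambda>j. x j - ?r y j / R) = q (\<lambda>j. R * x j - ?r y j) / R"
      using q_scale[of "1 / R"] R by simp
    also have "\<dots> \<le> \<epsilon>" using bd R by (simp add: field_simps)
    finally show "\<exists>u\<in>N. q (\<lambda>j. x j - u j) \<le> \<epsilon>" using y(1) by (auto simp: N_def)
  qed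
qed

text \<open>Successive approximation from the net bounds \<open>g\<close> on the unit ball of \<open>q\<close>, after which a
  single approximation gives the lower bound.\<close>
lemma net_comparison:
  assumes f: "coord_seminorm d f" and g: "coord_seminorm d g"
    and f_le: "\<And>x. f x \<le> q x"
    and ab: "0 < a" "0 < b" and \<epsilon>: "0 < \<epsilon>" "\<epsilon> \<le> 1 / 4" "16 * b * \<epsilon> \<le> a"
    and N_le: "\<And>u. u \<in> N \<Longrightarrow> q u \<le> 1"
    and N_cover: "\<And>x. q x \<le> 1 \<Longrightarrow> \<exists>u\<in>N. q (\<lambda>j. x j - u j) \<le> \<epsilon>"
    and N_cmp: "\<And>u. u \<in> N \<Longrightarrow> a * f u \<le> g u \<and> g u \<le> b * f u"
    and x: "q x \<le> 2 * f x"
  shows "a / 8 * f x \<le> g x \<and> g x \<le> 4 * b * f x"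
proof -
  interpret f: coord_seminorm d f by fact
  interpret g: coord_seminorm d g by fact
  define K where "K = (\<Sum>k<d. M * g (\<lambda>j. if j = k then 1 else 0))"
  have K: "0 \<le> K" unfolding K_def using M_pos g.q_nonneg by (intro sum_nonneg) auto
  \<comment> \<open>One step writes \<open>x\<close> as a net point plus \<open>\<epsilon>\<close>
    times a point of the unit ball. As \<open>\<epsilon>\<close> is below 1/2, a bound
    \<open>B\<close> improves to \<open>b + B / 2\<close>, whose fixed point is
    \<open>2 * b\<close>.\<close>
  have iter: "g x \<le> 2 * b + K * (1/2) ^ m" if "q x \<le> 1" for x m
    using that
  proof (induction m arbitrary: x)
    case 0
    have "g x \<le> (\<Sum>k<d. \<bar>x k\<bar> * g (\<lambda>j. if j = k then 1 else 0))" by (rule g.q_le_coords)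
    also have "\<dots> \<le> K" unfolding K_def
    proof (intro sum_mono mult_right_mono g.q_nonneg)
      fix k assume "k \<in> {..<d}"
      then have "\<bar>x k\<bar> \<le> M * q x" by (intro coord_le) simp
      also have "\<dots> \<le> M * 1" using 0 M_pos by (intro mult_left_mono) auto
      finally show "\<bar>x k\<bar> \<le> M" by simp
    qed
    finally show ?case using ab by simp
  next
    case (Suc m)
    obtain u where u: "u \<in> N" "q (\<lambda>j. x j - u j) \<le> \<epsilon>" using N_cover Suc.prems by blast
    define w where "w = (\<lambda>j. (1 / \<epsilon>) * (x j - u j))"
    have "q w \<le> 1" unfolding w_def q_scale using u \<epsilon> by (simp add: field_simps)
    then have w: "g w \<le> 2 * b + K * (1/2) ^ m" by (rule Suc.IH)
    have "g (\<lambda>j. x j - u j) = \<epsilon> * g w" unfolding w_def g.q_scale using \<epsilon> by simp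
    also have "\<dots> \<le> 1 / 2 * (2 * b + K * (1/2) ^ m)"
      using w \<epsilon> g.q_nonneg by (intro mult_mono) auto
    finally have "g (\<lambda>j. x j - u j) \<le> b + K * (1/2) ^ Suc m" by simp
    moreover have "g u \<le> b"
      using N_cmp[OF u(1)] f_le[of u] N_le[OF u(1)] ab mult_left_mono[of "f u" 1 b] by linarith
    ultimately show ?case using g.q_le_add_diff[of x u] by simp
  qed
  have g_unit: "g x \<le> 2 * b" if "q x \<le> 1" for x
  proof (rule LIMSEQ_le_const)
    have "(\<lambda>m. 2 * b + K * (1/2) ^ m) \<longlonglongrightarrow> 2 * b + K * 0"
      by (intro tendsto_intros LIMSEQ_power_zero) auto
    then show "(\<lambda>m. 2 * b + K * (1/2) ^ m) \<longlonglongrightarrow> 2 * b" by simp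
    show "\<exists>N. \<forall>n\<ge>N. g x \<le> 2 * b + K * (1/2) ^ n" using iter[OF that] by blast
  qed
  have g_le: "g x \<le> 2 * b * q x" for x
  proof (cases "q x = 0")
    case True
    have "g x \<le> (\<Sum>k<d. \<bar>x k\<bar> * g (\<lambda>j. if j = k then 1 else 0))" by (rule g.q_le_coords)
    also have "\<dots> = 0"
      using coord_le[of _ x] True by (intro sum.neutral) auto
    finally show ?thesis using True by simp
  next
    case False
    then have q: "0 < q x" using q_nonneg[of x] by simp
    then have "g (\<lambda>j. (1 / q x) * x j) \<le> 2 * b" by (intro g_unit, unfold q_scale) simp
    then show ?thesis unfolding g.q_scale using q by (simp add: field_simps)
  qed
  show ?thesis
  proof (cases "q x = 0")
    case True
    then have "f x = 0" using f_le[of x] f.q_nonneg[of x] by simp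
    then show ?thesis using g_le[of x] g.q_nonneg[of x] True by simp
  next
    case False
    then have q: "0 < q x" using q_nonneg[of x] by simp
    have "g x \<le> 2 * b * q x" by (rule g_le)
    also have "\<dots> \<le> 2 * b * (2 * f x)" using x ab by (intro mult_left_mono) auto
    finally have upper: "g x \<le> 4 * b * f x" by simp
    \<comment> \<open>The assumption \<open>q x <= 2 * f x\<close> puts \<open>f y\<close> between
      1/2 and 1, so a net point \<open>u\<close> near \<open>y\<close> has
      \<open>f u >= 1 / 4\<close>. The error \<open>2 * b * \<epsilon> <= a / 8\<close> then
      consumes at most half of \<open>a / 4\<close>.\<close>
    define y where "y = (\<lambda>j. (1 / q x) * x j)"
    have qy: "q y \<le> 1" and fy: "f y = f x / q x" and gy: "g y = g x / q x"
      unfolding y_def q_scale f.q_scale g.q_scale using q by simp_all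
    have fy2: "1 / 2 \<le> f y" using x q by (simp add: fy field_simps)
    have fy1: "f y \<le> 1" using f_le[of y] qy by simp
    obtain u where u: "u \<in> N" "q (\<lambda>j. y j - u j) \<le> \<epsilon>" using N_cover qy by blast
    have "1 / 4 \<le> f u"
      using f.q_le_add_diff[of y u] f_le[of "\<lambda>j. y j - u j"] u \<epsilon> fy2 by linarith
    then have "a * (1 / 4) \<le> g u"
      using N_cmp[OF u(1)] ab mult_left_mono[of "1 / 4" "f u" a] by linarith
    moreover have "g u \<le> g y + g (\<lambda>j. y j - u j)"
      using g.q_le_add_diff[of u y] g.q_diff_commute[of u y] by simp
    moreover have "g (\<lambda>j. y j - u j) \<le> 2 * b * \<epsilon>"
      using g_le[of "\<lambda>j. y j - u j"] u ab by (elim order_trans) (simp add: mult_left_mono)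
    ultimately have "a / 8 * 1 \<le> g y" using \<epsilon> by linarith
    moreover have "a / 8 * f y \<le> a / 8 * 1" using fy1 ab by (intro mult_left_mono) auto
    ultimately have "a / 8 * f y \<le> g y" by linarith
    then have "a / 8 * f x \<le> g x" using q by (simp add: fy gy field_simps)
    then show ?thesis using upper by simp
  qed
qed

end

section \<open>Passing from one vector to all vectors\<close>

lemma mat_vec_add: "mat_vec k M (\<lambda>j. x j + y j) i = mat_vec k M x i + mat_vec k M y i"
  by (simp add: mat_vec_def distrib_left sum.distrib)

lemma mat_vec_scale: "mat_vec k M (\<lambda>j. t * x j) i = t * mat_vec k M x i"
  by (simp add: mat_vec_def sum_distrib_left mult_ac)

lemma mat_vec_cong: "(\<And>j. j < k \<Longrightarrow> x j = y j) \<Longrightarrow> mat_vec k M x = mat_vec k M y"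
  by (simp add: mat_vec_def)

lemma coord_seminorm_lp_norm:
  assumes "1 \<le> p"
  shows "coord_seminorm m (lp_norm p m)"
  by unfold_locales (rule lp_norm_cong lp_norm_triangle[OF assms] lp_norm_scale[OF assms], assumption?)+

lemma coord_seminorm_mat_vec:
  assumes "coord_seminorm m f"
  shows "coord_seminorm d (\<lambda>x. f (mat_vec d A x))"
proof -
  interpret coord_seminorm m f by fact
  show ?thesis
  proof
    fix x y :: "nat \<Rightarrow> real" assume "\<And>j. j < d \<Longrightarrow> x j = y j"
    then show "f (mat_vec d A x) = f (mat_vec d A y)" by (simp add: mat_vec_cong[of d x y])
  next
    fix x y
    have "mat_vec d A (\<lambda>j. x j + y j) = (\<lambda>i. mat_vec d A x i + mat_vec d A y i)"
      by (simp add: fun_eq_iff mat_vec_add)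
    then show "f (mat_vec d A (\<lambda>j. x j + y j)) \<le> f (mat_vec d A x) + f (mat_vec d A y)"
      using q_triangle by simp
  next
    fix t x
    have "mat_vec d A (\<lambda>j. t * x j) = (\<lambda>i. t * mat_vec d A x i)"
      by (simp add: fun_eq_iff mat_vec_scale)
    then show "f (mat_vec d A (\<lambda>j. t * x j)) = \<bar>t\<bar> * f (mat_vec d A x)"
      using q_scale by simp
  qed
qed

lemma rational_approximation:
  fixes x :: "nat \<Rightarrow> real"
  obtains y where "\<And>m. y m \<in> PiE {..<d} (\<lambda>_. \<rat>)" "\<And>k. k < d \<Longrightarrow> (\<lambda>m. y m k) \<longlonglongrightarrow> x k"
proof -
  have "\<exists>z. (\<forall>m. z m \<in> \<rat>) \<and> z \<longlonglongrightarrow> x k" for k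
    using closure_sequential[of "x k" \<rat>] Rats_closure_real by auto
  then obtain z where z: "\<And>k m. z k m \<in> \<rat>" "\<And>k. z k \<longlonglongrightarrow> x k" by metis
  show thesis by (rule that[of "\<lambda>m. restrict (\<lambda>k. z k m) {..<d}"]) (use z in auto)
qed

section \<open>Success events of the sketch and their probability\<close>

lemma lp_norm_sketch_measurable:
  assumes "sets D = sets borel"
  shows "(\<lambda>X. lp_norm p r (mat_vec n (\<lambda>i j. s * X (i, j)) y))
    \<in> borel_measurable (PiM ({..<r} \<times> {..<n}) (\<lambda>_. D))"
proof -
  have coord: "(\<lambda>X. X (i, j)) \<in> borel_measurable (PiM ({..<r} \<times> {..<n}) (\<lambda>_. D))"
    if "i < r" "j < n" for i j
    using measurable_component_singleton[of "(i, j)" "{..<r} \<times> {..<n}" "\<lambda>_. D"] that assms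
    by (simp cong: measurable_cong_sets)
  have "(\<lambda>X. \<Sum>i<r. \<bar>\<Sum>j<n. s * X (i, j) * y j\<bar> powr p)
      \<in> borel_measurable (PiM ({..<r} \<times> {..<n}) (\<lambda>_. D))"
  proof (intro borel_measurable_sum measurable_abs_powr borel_measurable_times borel_measurable_const)
    show "(\<lambda>X. X (i, j)) \<in> borel_measurable (PiM ({..<r} \<times> {..<n}) (\<lambda>_. D))"
      if "i \<in> {..<r}" "j \<in> {..<n}" for i j using that by (intro coord) auto
  qed
  then show ?thesis
    unfolding lp_norm_def mat_vec_def by (rule powr_real_measurable) (rule borel_measurable_const)
qed

text \<open>Indexed by the sketched vector \<open>y\<close> rather than by a preimage under
  \<open>A\<close>, so that the estimate for one vector involves neither \<open>A\<close> nor
  \<open>d\<close>.\<close>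

definition sketch_good ::
  "real \<Rightarrow> nat \<Rightarrow> nat \<Rightarrow> real measure \<Rightarrow> real \<Rightarrow> real \<Rightarrow> (nat \<Rightarrow> real) \<Rightarrow> (nat \<times> nat \<Rightarrow> real) set" where
  "sketch_good p r n D a b y = {X \<in> space (PiM ({..<r} \<times> {..<n}) (\<lambda>_. D)).
     a * lp_norm p n y
       \<le> lp_norm p r (mat_vec n (\<lambda>i j. (real r * ln (real r)) powr (- 1 / p) * X (i, j)) y) \<and>
     lp_norm p r (mat_vec n (\<lambda>i j. (real r * ln (real r)) powr (- 1 / p) * X (i, j)) y)
       \<le> b * lp_norm p n y}"

lemma sketch_good_sets:
  assumes "sets D = sets borel"
  shows "sketch_good p r n D a b y \<in> sets (PiM ({..<r} \<times> {..<n}) (\<lambda>_. D))"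
proof -
  note [measurable] = lp_norm_sketch_measurable[OF assms, of p r n "(real r * ln (real r)) powr (- 1 / p)" y]
  show ?thesis unfolding sketch_good_def by measurable
qed

text \<open>Intersecting with the space covers empty \<open>F\<close>, for which the inner
  intersection is \<open>UNIV\<close>.\<close>

lemma space_Int_INT_sets:
  assumes "finite F" "\<And>x. x \<in> F \<Longrightarrow> G x \<in> sets P"
  shows "space P \<inter> (\<Inter>x\<in>F. G x) \<in> sets P"
  using assms
proof (induction F)
  case (insert x F)
  have "space P \<inter> (\<Inter>x\<in>insert x F. G x) = G x \<inter> (space P \<inter> (\<Inter>x\<in>F. G x))" by auto
  then show ?case using insert by auto
qed simp

text \<open>Takes care of the kernel of \<open>A\<close>, where the image vector cannot be
  normalised.\<close>

lemma sketch_good_zero: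
  assumes "1 \<le> p" "lp_norm p n y = 0"
  shows "sketch_good p r n D a b y = space (PiM ({..<r} \<times> {..<n}) (\<lambda>_. D))"
proof -
  have "\<forall>j<n. y j = 0" using assms by (simp add: lp_norm_eq_0_iff)
  then have "lp_norm p r (mat_vec n B y) = 0" for B
    using assms by (subst lp_norm_eq_0_iff) (auto simp: mat_vec_def)
  then show ?thesis using assms by (auto simp: sketch_good_def)
qed

text \<open>By homogeneity \<open>y\<close> may be normalised; before scaling, its sketch then
  consists of \<open>r\<close> independent standard stable variables whatever \<open>n\<close> and
  \<open>y\<close> are, hence the uniform constants. The scaling removes the factor
  \<open>r * ln r\<close> from the sum of powers, and \<open>p\<close>-th roots are taken.\<close>

lemma single_vector:
  assumes p: "1 \<le> p" "p < 2"
  shows "\<exists>a b C. 0 < a \<and> a \<le> b \<and> 0 < C \<and>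
    (\<forall>D r n y. std_sym_p_stable p D \<longrightarrow> 3 \<le> r \<longrightarrow>
      1 - C / ln (real r) \<le> measure (PiM ({..<r} \<times> {..<n}) (\<lambda>_. D)) (sketch_good p r n D a b y))"
proof -
  obtain \<alpha> \<beta> C where ab: "0 < \<alpha>" "\<alpha> \<le> \<beta>" and C: "0 < C"
    and conc: "\<And>(P :: (nat \<times> nat \<Rightarrow> real) measure) r Z. prob_space P \<Longrightarrow> 3 \<le> r \<Longrightarrow>
      prob_space.indep_vars P (\<lambda>_. borel) Z {..<r} \<Longrightarrow>
      (\<forall>i<r. std_sym_p_stable p (distr P borel (Z i))) \<Longrightarrow>
      1 - C / ln (real r) \<le> measure P {x \<in> space P.
        \<alpha> * (real r * ln (real r)) \<le> (\<Sum>i<r. \<bar>Z i x\<bar> powr p) \<and>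
        (\<Sum>i<r. \<bar>Z i x\<bar> powr p) \<le> \<beta> * (real r * ln (real r))}"
    using stable_concentration[OF p, where 'a = "nat \<times> nat \<Rightarrow> real"] by blast
  have main: "1 - C / ln (real r)
      \<le> measure (PiM ({..<r} \<times> {..<n}) (\<lambda>_. D)) (sketch_good p r n D (\<alpha> powr (1 / p)) (\<beta> powr (1 / p)) y)"
    if D: "std_sym_p_stable p D" and r: "3 \<le> r" for D r n y
  proof -
    interpret D: real_distribution D using D by (simp add: std_sym_p_stable_def)
    define P where "P = PiM ({..<r} \<times> {..<n}) (\<lambda>_. D)"
    interpret P: prob_space P unfolding P_def by (intro prob_space_PiM D.prob_space_axioms)
    have L: "0 < ln (real r)" using r by simp
    show ?thesis
    proof (cases "lp_norm p n y = 0")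
      case True
      then have "measure P (sketch_good p r n D (\<alpha> powr (1 / p)) (\<beta> powr (1 / p)) y) = 1"
        using p P.prob_space by (simp add: sketch_good_zero P_def)
      then show ?thesis using C L by (simp add: P_def)
    next
      case False
      define N where "N = lp_norm p n y"
      have N: "0 < N" using False lp_norm_nonneg[of p n y] by (simp add: N_def less_le)
      define u where "u = (\<lambda>j. y j / N)"
      have u: "(\<Sum>j<n. \<bar>u j\<bar> powr p) = 1"
        using N p lp_norm_powr[of p n y]
        by (simp add: u_def powr_divide N_def[symmetric] flip: sum_divide_distrib)
          (metis N_def powr_gt_zero less_irrefl)
      define Z where "Z = (\<lambda>i (X :: nat \<times> nat \<Rightarrow> real). \<Sum>j<n. X (i, j) * u j)"
      define T where "T = real r * ln (real r)"
      have T: "0 < T" using L r by (simp add: T_def)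
      note comb = std_sym_p_stable_combination[OF D u, where r = r, folded P_def]
      have "1 - C / ln (real r) \<le> P.prob {x \<in> space P.
        \<alpha> * T \<le> (\<Sum>i<r. \<bar>Z i x\<bar> powr p) \<and> (\<Sum>i<r. \<bar>Z i x\<bar> powr p) \<le> \<beta> * T}"
        unfolding T_def using comb by (intro conc r) (auto simp: Z_def)
      also have "\<dots> \<le> P.prob (sketch_good p r n D (\<alpha> powr (1 / p)) (\<beta> powr (1 / p)) y)"
      proof (intro P.finite_measure_mono subsetI)
        show "sketch_good p r n D (\<alpha> powr (1 / p)) (\<beta> powr (1 / p)) y \<in> P.events"
          unfolding P_def by (rule sketch_good_sets) simp
        fix X assume X: "X \<in> {x \<in> space P. \<alpha> * T \<le> (\<Sum>i<r. \<bar>Z i x\<bar> powr p) \<and> (\<Sum>i<r. \<bar>Z i x\<bar> powr p) \<le> \<beta> * T}"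
        define S where "S = (\<Sum>i<r. \<bar>Z i X\<bar> powr p)"
        have "(\<lambda>i. mat_vec n (\<lambda>i j. T powr (- 1 / p) * X (i, j)) y i) = (\<lambda>i. (T powr (- 1 / p) * N) * Z i X)"
          using N by (simp add: fun_eq_iff mat_vec_def Z_def u_def sum_distrib_left mult_ac)
        then have "lp_norm p r (mat_vec n (\<lambda>i j. T powr (- 1 / p) * X (i, j)) y)
            = T powr (- 1 / p) * N * lp_norm p r (\<lambda>i. Z i X)"
          using lp_norm_scale[OF p(1), of r "T powr (- 1 / p) * N" "\<lambda>i. Z i X"] N by simp
        also have "lp_norm p r (\<lambda>i. Z i X) = S powr (1 / p)" by (simp add: lp_norm_def S_def)
        also have "T powr (- 1 / p) * N * S powr (1 / p) = N * (S / T) powr (1 / p)"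
        proof -
          have "T powr (- 1 / p) = inverse (T powr (1 / p))" by (simp flip: powr_minus)
          moreover
          have "(S / T) powr (1 / p) = S powr (1 / p) / T powr (1 / p)"
            by (rule powr_divide)
          ultimately show ?thesis by (simp add: divide_inverse)
        qed
        finally have eq: "lp_norm p r (mat_vec n (\<lambda>i j. T powr (- 1 / p) * X (i, j)) y) = N * (S / T) powr (1 / p)" .
        have "\<alpha> \<le> S / T" "S / T \<le> \<beta>" using X T by (auto simp: S_def field_simps)
        then have "\<alpha> powr (1 / p) \<le> (S / T) powr (1 / p)" "(S / T) powr (1 / p) \<le> \<beta> powr (1 / p)"
          using ab p by (auto intro!: powr_mono2)
        then show "X \<in> sketch_good p r n D (\<alpha> powr (1 / p)) (\<beta> powr (1 / p)) y"
          using X N eq unfolding sketch_good_def T_def[symmetric] N_def[symmetric]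
          by (simp add: P_def mult.commute)
      qed
      finally show ?thesis by (simp add: P_def)
    qed
  qed
  show ?thesis
  proof (intro exI conjI allI impI)
    show "0 < \<alpha> powr (1 / p)" using ab by simp
    show "\<alpha> powr (1 / p) \<le> \<beta> powr (1 / p)" using ab p by (intro powr_mono2) auto
  qed (fact C, fact main)
qed

text \<open>The factor \<open>1 / M\<close> makes \<open>x \<mapsto> lp_norm p n (A x)\<close> into a norm even if \<open>A\<close> is not
  injective; the size of the net does not depend on \<open>M\<close>.\<close>
lemma finitely_many_vectors:
  fixes A :: "nat \<Rightarrow> nat \<Rightarrow> real"
  assumes p: "1 \<le> p" and D: "std_sym_p_stable p D" and d: "0 < d"
    and ab: "0 < a" "0 < b" and \<epsilon>: "0 < \<epsilon>" "\<epsilon> \<le> 1 / 4" "16 * b * \<epsilon> \<le> a"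
    and single: "\<And>y. 1 - \<eta> \<le> measure (PiM ({..<r} \<times> {..<n}) (\<lambda>_. D)) (sketch_good p r n D a b y)"
    and \<eta>: "(16 / \<epsilon>) ^ d * \<eta> \<le> \<delta>"
    and F: "finite F"
  shows "1 - \<delta> \<le> measure (PiM ({..<r} \<times> {..<n}) (\<lambda>_. D))
    (space (PiM ({..<r} \<times> {..<n}) (\<lambda>_. D)) \<inter> (\<Inter>x\<in>F. sketch_good p r n D (a / 8) (4 * b) (mat_vec d A x)))"
proof -
  interpret D: real_distribution D using D by (simp add: std_sym_p_stable_def)
  define P where "P = PiM ({..<r} \<times> {..<n}) (\<lambda>_. D)"
  interpret P: prob_space P unfolding P_def by (intro prob_space_PiM D.prob_space_axioms)
  have good_sets: "sketch_good p r n D a b y \<in> P.events" for a b y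
    unfolding P_def by (rule sketch_good_sets) simp
  define f where "f = (\<lambda>x. lp_norm p n (mat_vec d A x))"
  interpret f: coord_seminorm d f
    unfolding f_def by (rule coord_seminorm_mat_vec, rule coord_seminorm_lp_norm, rule p)
  \<comment> \<open>Large enough that the term added to \<open>f x\<close> in \<open>q x\<close> is
    at most \<open>f x\<close> on \<open>F\<close>, whence \<open>q x <= 2 * f x\<close>. Where
    \<open>f x = 0\<close> the quotient is 0 by convention; such \<open>x\<close> are left to
    \<open>sketch_good_zero\<close>.\<close>
  define M where "M = 1 + (\<Sum>x\<in>F. (\<Sum>j<d. \<bar>x j\<bar>) / f x)"
  have M: "1 \<le> M" unfolding M_def using f.q_nonneg by (auto intro!: sum_nonneg)
  have M_F: "(\<Sum>j<d. \<bar>x j\<bar>) / M \<le> f x" if "x \<in> F" "f x \<noteq> 0" for x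
  proof -
    have "(\<Sum>j<d. \<bar>x j\<bar>) / f x \<le> (\<Sum>x\<in>F. (\<Sum>j<d. \<bar>x j\<bar>) / f x)"
      using F that f.q_nonneg by (intro member_le_sum) (auto intro!: sum_nonneg)
    then have "(\<Sum>j<d. \<bar>x j\<bar>) / f x \<le> M" by (simp add: M_def)
    then show ?thesis using that f.q_nonneg[of x] M by (simp add: field_simps)
  qed
  define q where "q = (\<lambda>x. f x + (\<Sum>j<d. \<bar>x j\<bar>) / M)"
  interpret q: coord_norm d q M
  proof
    fix x y :: "nat \<Rightarrow> real" assume *: "\<And>j. j < d \<Longrightarrow> x j = y j"
    then show "q x = q y" using f.q_cong[of x y] by (simp add: q_def)
  next
    fix x y
    have "(\<Sum>j<d. \<bar>x j + y j\<bar>) / M \<le> (\<Sum>j<d. \<bar>x j\<bar> + \<bar>y j\<bar>) / M"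
      using M by (intro divide_right_mono sum_mono) auto
    then show "q (\<lambda>j. x j + y j) \<le> q x + q y"
      using f.q_triangle[of x y] by (simp add: q_def sum.distrib add_divide_distrib)
  next
    fix t x show "q (\<lambda>j. t * x j) = \<bar>t\<bar> * q x"
      by (simp add: q_def f.q_scale abs_mult distrib_left flip: sum_distrib_left)
  next
    fix j and x :: "nat \<Rightarrow> real" assume "j < d"
    then have "\<bar>x j\<bar> \<le> (\<Sum>j<d. \<bar>x j\<bar>)" using member_le_sum[of j "{..<d}" "\<lambda>j. \<bar>x j\<bar>"] by simp
    also have "\<dots> \<le> M * q x" using M f.q_nonneg[of x] by (simp add: q_def distrib_left)
    finally show "\<bar>x j\<bar> \<le> M * q x" .
  qed (use M d in auto)
  have f_le_q: "f x \<le> q x" for x using M by (simp add: q_def sum_nonneg)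
  have "\<exists>N. finite N \<and> real (card N) \<le> (16 / \<epsilon>) ^ d \<and> (\<forall>u\<in>N. q u \<le> 1) \<and>
      (\<forall>x. q x \<le> 1 \<longrightarrow> (\<exists>u\<in>N. q (\<lambda>j. x j - u j) \<le> \<epsilon>))"
    using \<epsilon> by (intro q.ex_net) auto
  then obtain N where N: "finite N" "real (card N) \<le> (16 / \<epsilon>) ^ d" "\<And>u. u \<in> N \<Longrightarrow> q u \<le> 1"
    "\<And>x. q x \<le> 1 \<Longrightarrow> \<exists>u\<in>N. q (\<lambda>j. x j - u j) \<le> \<epsilon>" by blast
  let ?H = "\<lambda>u. sketch_good p r n D a b (mat_vec d A u)"
  have \<eta>0: "0 \<le> \<eta>"
    using single[of "\<lambda>_. 0"] P.prob_le_1[of "sketch_good p r n D a b (\<lambda>_. 0)"] by (simp add: P_def)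
  have bad_sets: "(\<Union>u\<in>N. space P - ?H u) \<in> P.events"
    using N good_sets by (intro sets.finite_UN) auto
  have "P.prob (\<Union>u\<in>N. space P - ?H u) \<le> (\<Sum>u\<in>N. P.prob (space P - ?H u))"
    using N good_sets by (intro P.finite_measure_subadditive_finite) auto
  also have "\<dots> \<le> (\<Sum>u\<in>N. \<eta>)"
  proof (intro sum_mono)
    show "P.prob (space P - ?H u) \<le> \<eta>" for u
      using single[of "mat_vec d A u"] P.prob_compl[OF good_sets[of a b "mat_vec d A u"]] unfolding P_def by simp
  qed
  also have "\<dots> \<le> (16 / \<epsilon>) ^ d * \<eta>" using N \<eta>0 by (simp add: mult_right_mono)
  also note \<eta>
  finally have "1 - \<delta> \<le> P.prob (space P - (\<Union>u\<in>N. space P - ?H u))"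
    unfolding P.prob_compl[OF bad_sets] by simp
  also have "\<dots> \<le> P.prob (space P \<inter> (\<Inter>x\<in>F. sketch_good p r n D (a / 8) (4 * b) (mat_vec d A x)))"
  proof (intro P.finite_measure_mono subsetI IntI INT_I)
    show "space P \<inter> (\<Inter>x\<in>F. sketch_good p r n D (a / 8) (4 * b) (mat_vec d A x)) \<in> P.events"
      using F good_sets by (intro space_Int_INT_sets)
  next
    fix X assume X: "X \<in> space P - (\<Union>u\<in>N. space P - ?H u)"
    then show "X \<in> space P" by simp
    fix x assume x: "x \<in> F"
    define B where "B = (\<lambda>i j. (real r * ln (real r)) powr (- 1 / p) * X (i, j))"
    show "X \<in> sketch_good p r n D (a / 8) (4 * b) (mat_vec d A x)"
    proof (cases "f x = 0")
      case True
      then show ?thesis using X p by (subst sketch_good_zero) (auto simp: f_def P_def)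
    next
      case False
      have "a / 8 * f x \<le> lp_norm p r (mat_vec n B (mat_vec d A x)) \<and>
          lp_norm p r (mat_vec n B (mat_vec d A x)) \<le> 4 * b * f x"
      proof (rule q.net_comparison[OF f.coord_seminorm_axioms _ f_le_q ab \<epsilon> N(3) N(4)])
        show "coord_seminorm d (\<lambda>x. lp_norm p r (mat_vec n B (mat_vec d A x)))"
          by (rule coord_seminorm_mat_vec, rule coord_seminorm_mat_vec, rule coord_seminorm_lp_norm, rule p)
        show "a * f u \<le> lp_norm p r (mat_vec n B (mat_vec d A u)) \<and>
            lp_norm p r (mat_vec n B (mat_vec d A u)) \<le> b * f u" if "u \<in> N" for u
          using X that by (auto simp: sketch_good_def f_def B_def)
        show "q x \<le> 2 * f x" using M_F[OF x False] by (simp add: q_def)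
      qed
      then show ?thesis using X by (simp add: sketch_good_def f_def B_def P_def)
    qed
  qed
  finally show ?thesis by (simp add: P_def)
qed

text \<open>As the bound is uniform over finite sets, continuity from above carries it to the
  countably many rational vectors, and continuity of seminorms to all. The identity of events found
  on the way also shows that the uncountable intersection is measurable.\<close>

lemma all_vectors:
  fixes A :: "nat \<Rightarrow> nat \<Rightarrow> real"
  assumes p: "1 \<le> p" and D: "std_sym_p_stable p D"
    and fin: "\<And>F. finite F \<Longrightarrow> \<theta> \<le> measure (PiM ({..<r} \<times> {..<n}) (\<lambda>_. D))
      (space (PiM ({..<r} \<times> {..<n}) (\<lambda>_. D)) \<inter> (\<Inter>x\<in>F. sketch_good p r n D a b (mat_vec d A x)))"
  shows "\<theta> \<le> measure (PiM ({..<r} \<times> {..<n}) (\<lambda>_. D)) (\<Inter>x. sketch_good p r n D a b (mat_vec d A x))"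
proof -
  interpret D: real_distribution D using D by (simp add: std_sym_p_stable_def)
  define P where "P = PiM ({..<r} \<times> {..<n}) (\<lambda>_. D)"
  interpret P: prob_space P unfolding P_def by (intro prob_space_PiM D.prob_space_axioms)
  let ?G = "\<lambda>x. sketch_good p r n D a b (mat_vec d A x)"
  have good_sets: "?G x \<in> P.events" for x unfolding P_def by (rule sketch_good_sets) simp
  define Q :: "(nat \<Rightarrow> real) set" where "Q = PiE {..<d} (\<lambda>_. \<rat>)"
  have Q: "countable Q" "Q \<noteq> {}"
    unfolding Q_def by (auto intro!: countable_PiE simp: countable_rat PiE_eq_empty_iff)
  define e where "e = from_nat_into Q"
  have range_e: "range e = Q" unfolding e_def using Q by (intro range_from_nat_into)
  define E where "E m = space P \<inter> (\<Inter>x\<in>e ` {..m}. ?G x)" for m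
  have E_sets: "range E \<subseteq> P.events"
    unfolding E_def using good_sets by (intro image_subsetI space_Int_INT_sets) auto
  have "decseq E" by (auto simp: decseq_def E_def)
  from P.finite_Lim_measure_decseq[OF E_sets this]
  have lim: "(\<lambda>m. P.prob (E m)) \<longlonglongrightarrow> P.prob (\<Inter>m. E m)" .
  have "\<theta> \<le> P.prob (E m)" for m unfolding E_def P_def by (intro fin) auto
  then have "\<theta> \<le> P.prob (\<Inter>m. E m)" by (intro LIMSEQ_le_const[OF lim]) auto
  also have "(\<Inter>m. E m) = (\<Inter>x. ?G x)"
  proof (intro subset_antisym subsetI INT_I)
    fix X assume "X \<in> (\<Inter>x. ?G x)"
    then show "X \<in> E m" for m by (auto simp: E_def sketch_good_def P_def)
  next
    fix X x assume X: "X \<in> (\<Inter>m. E m)"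
    define B where "B = (\<lambda>i j. (real r * ln (real r)) powr (- 1 / p) * X (i, j))"
    define f where "f = (\<lambda>x. lp_norm p n (mat_vec d A x))"
    define g where "g = (\<lambda>x. lp_norm p r (mat_vec n B (mat_vec d A x)))"
    interpret f: coord_seminorm d f
      unfolding f_def by (rule coord_seminorm_mat_vec, rule coord_seminorm_lp_norm, rule p)
    interpret g: coord_seminorm d g
      unfolding g_def by (rule coord_seminorm_mat_vec, rule coord_seminorm_mat_vec, rule coord_seminorm_lp_norm, rule p)
    have rat: "a * f y \<le> g y \<and> g y \<le> b * f y" if y: "y \<in> Q" for y
    proof -
      obtain m where "y = e m" using y range_e by blast
      moreover have "X \<in> E m" using X by blast
      ultimately have "X \<in> ?G y" by (auto simp: E_def)
      then show ?thesis by (simp add: sketch_good_def f_def g_def B_def)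
    qed
    obtain y where y: "\<And>m. y m \<in> Q" "\<And>k. k < d \<Longrightarrow> (\<lambda>m. y m k) \<longlonglongrightarrow> x k"
      unfolding Q_def using rational_approximation[of d x] by blast
    have lims: "(\<lambda>m. f (y m)) \<longlonglongrightarrow> f x" "(\<lambda>m. g (y m)) \<longlonglongrightarrow> g x"
      using f.q_tendsto g.q_tendsto y(2) by blast+
    have "a * f x \<le> g x"
      by (rule LIMSEQ_le[OF tendsto_mult_left[OF lims(1)] lims(2)]) (use rat y(1) in blast)
    moreover have "g x \<le> b * f x"
      by (rule LIMSEQ_le[OF lims(2) tendsto_mult_left[OF lims(1)]]) (use rat y(1) in blast)
    moreover have "X \<in> space P" using X by (auto simp: E_def)
    ultimately show "X \<in> ?G x" by (simp add: sketch_good_def f_def g_def B_def P_def)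
  qed
  finally show ?thesis by (simp add: P_def)
qed

theorem theorem2:
  fixes p :: real and D :: "real measure"
  assumes "1 \<le> p" and "p < 2"
    and "std_sym_p_stable p D"
  shows "\<exists>c \<kappa> a b. c > 0 \<and> \<kappa> \<ge> 1 \<and> 0 < a \<and> a \<le> b \<and> b / a \<le> \<kappa> \<and>
    (\<forall>d n :: nat. d \<ge> 1 \<longrightarrow> n \<ge> 1 \<longrightarrow>
      (let r = nat \<lceil>exp (exp (c * real d))\<rceil>;
           s = (real r * ln (real r)) powr (- 1 / p);
           P = PiM ({..<r} \<times> {..<n}) (\<lambda>_. D)
       in \<forall>A :: nat \<Rightarrow> nat \<Rightarrow> real.
            measure P {X \<in> space P. \<forall>x :: nat \<Rightarrow> real.
               a * lp_norm p n (mat_vec d A x)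
                 \<le> lp_norm p r (mat_vec n (\<lambda>i j. s * X (i, j)) (mat_vec d A x)) \<and>
               lp_norm p r (mat_vec n (\<lambda>i j. s * X (i, j)) (mat_vec d A x))
                 \<le> b * lp_norm p n (mat_vec d A x)} \<ge> 0.99))"
proof -
  from single_vector[OF assms(1,2)]
  obtain a b C where ab: "0 < a" "a \<le> b" and C: "0 < C"
    and all: "\<forall>D r n y. std_sym_p_stable p D \<longrightarrow> 3 \<le> r \<longrightarrow>
      1 - C / ln (real r) \<le> measure (PiM ({..<r} \<times> {..<n}) (\<lambda>_. D)) (sketch_good p r n D a b y)"
    by (elim exE conjE)
  have single: "1 - C / ln (real r) \<le> measure (PiM ({..<r} \<times> {..<n}) (\<lambda>_. D)) (sketch_good p r n D a b y)"
    if "3 \<le> r" for r n y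
    by (rule all[rule_format, OF assms(3) that])
  \<comment> \<open>The value with \<open>16 * b * \<epsilon> = a\<close>, the largest that
    \<open>net_comparison\<close> admits; it depends on neither \<open>d\<close> nor
    \<open>n\<close>.\<close>
  define \<epsilon> where "\<epsilon> = a / (16 * b)"
  have \<epsilon>: "0 < \<epsilon>" "\<epsilon> \<le> 1 / 4" "16 * b * \<epsilon> \<le> a" using ab by (auto simp: \<epsilon>_def field_simps)
  \<comment> \<open>\<open>16 / \<epsilon>\<close> is the base of the net size. Since
    \<open>d >= 1\<close>, the power \<open>(1 + 100 * C) ^ d\<close> exceeds
    \<open>100 * C\<close>, so \<open>ln r >= L ^ d\<close> brings the total failure probability
    down to 1/100.\<close>
  define L where "L = 16 / \<epsilon> * (1 + 100 * C)"
  have L: "0 < L" using \<epsilon> C by (simp add: L_def)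
  \<comment> \<open>\<open>L <= exp c\<close> gives \<open>ln r >= L ^ d\<close>, and
    \<open>1 <= c\<close> guarantees \<open>3 <= r\<close>.\<close>
  define c where "c = max 1 (ln L)"
  have c: "1 \<le> c" "L \<le> exp c"
  proof -
    have "L = exp (ln L)" using L by simp
    also have "\<dots> \<le> exp c" by (simp add: c_def)
    finally show "L \<le> exp c" .
  qed (simp add: c_def)
  have main: "0.99 \<le> measure (PiM ({..<r} \<times> {..<n}) (\<lambda>_. D))
      (\<Inter>x. sketch_good p r n D (a / 8) (4 * b) (mat_vec d A x))"
    if d: "1 \<le> d" and r: "r = nat \<lceil>exp (exp (c * real d))\<rceil>" for d n r A
  proof -
    have rr: "exp (exp (c * real d)) \<le> real r" unfolding r by linarith
    have "1 * 1 \<le> c * real d" using c d by (intro mult_mono) auto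
    then have "2 \<le> exp (c * real d)" using exp_ge_add_one_self[of "c * real d"] by linarith
    then have "3 \<le> exp (exp (c * real d))" using exp_ge_add_one_self[of "exp (c * real d)"] by linarith
    then have r3: "3 \<le> r" using rr by linarith
    have "ln (exp (exp (c * real d))) \<le> ln (real r)" using rr r3 by (subst ln_le_cancel_iff) auto
    then have lr: "exp (c * real d) \<le> ln (real r)" by simp
    have "(16 / \<epsilon>) ^ d * (100 * C) \<le> (16 / \<epsilon>) ^ d * (1 + 100 * C) ^ d"
    proof (intro mult_left_mono)
      have "(1 + 100 * C) ^ 1 \<le> (1 + 100 * C) ^ d" using C d by (intro power_increasing) auto
      then show "100 * C \<le> (1 + 100 * C) ^ d" by simp
    qed (use \<epsilon> in simp)
    also have "\<dots> = L ^ d" unfolding L_def by (rule power_mult_distrib[symmetric])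
    also have "\<dots> \<le> exp c ^ d" using c L by (intro power_mono) auto
    also have "\<dots> = exp (c * real d)" by (metis exp_of_nat_mult mult.commute)
    finally have "(16 / \<epsilon>) ^ d * (100 * C) \<le> ln (real r)" using lr by simp
    moreover have "0 < ln (real r)" using r3 by simp
    ultimately have \<eta>: "(16 / \<epsilon>) ^ d * (C / ln (real r)) \<le> 1 / 100"
      unfolding times_divide_eq_right by (subst pos_divide_le_eq) auto
    have "1 - 1 / 100 \<le> measure (PiM ({..<r} \<times> {..<n}) (\<lambda>_. D))
      (\<Inter>x. sketch_good p r n D (a / 8) (4 * b) (mat_vec d A x))"
      using ab d \<epsilon>
      by (intro all_vectors finitely_many_vectors[OF assms(1,3) _ _ _ _ _ _ single[OF r3] \<eta>] assms) auto
    then show ?thesis by simp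
  qed
  have Int_eq: "{X \<in> space (PiM ({..<r} \<times> {..<n}) (\<lambda>_. D)). \<forall>x :: nat \<Rightarrow> real.
       a / 8 * lp_norm p n (mat_vec d A x)
         \<le> lp_norm p r (mat_vec n (\<lambda>i j. (real r * ln (real r)) powr (- 1 / p) * X (i, j)) (mat_vec d A x)) \<and>
       lp_norm p r (mat_vec n (\<lambda>i j. (real r * ln (real r)) powr (- 1 / p) * X (i, j)) (mat_vec d A x))
         \<le> 4 * b * lp_norm p n (mat_vec d A x)}
    = (\<Inter>x. sketch_good p r n D (a / 8) (4 * b) (mat_vec d A x))" for r n d A
    by (auto simp: sketch_good_def)
  show ?thesis
    unfolding Let_def
  \<comment> \<open>The factors 1/8 and 4 are the losses incurred in \<open>net_comparison\<close>;
    the distortion is the ratio of the two bounds.\<close>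
  proof (rule exI[of _ c], rule exI[of _ "4 * b / (a / 8)"], rule exI[of _ "a / 8"],
      rule exI[of _ "4 * b"], intro conjI allI impI)
    fix d n :: nat and A :: "nat \<Rightarrow> nat \<Rightarrow> real"
    assume "1 \<le> d"
    then show "0.99 \<le> measure (PiM ({..<nat \<lceil>exp (exp (c * real d))\<rceil>} \<times> {..<n}) (\<lambda>_. D))
      {X \<in> space (PiM ({..<nat \<lceil>exp (exp (c * real d))\<rceil>} \<times> {..<n}) (\<lambda>_. D)). \<forall>x :: nat \<Rightarrow> real.
       a / 8 * lp_norm p n (mat_vec d A x)
         \<le> lp_norm p (nat \<lceil>exp (exp (c * real d))\<rceil>) (mat_vec n (\<lambda>i j. (real (nat \<lceil>exp (exp (c * real d))\<rceil>) * ln (real (nat \<lceil>exp (exp (c * real d))\<rceil>))) powr (- 1 / p) * X (i, j)) (mat_vec d A x)) \<and>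
       lp_norm p (nat \<lceil>exp (exp (c * real d))\<rceil>) (mat_vec n (\<lambda>i j. (real (nat \<lceil>exp (exp (c * real d))\<rceil>) * ln (real (nat \<lceil>exp (exp (c * real d))\<rceil>))) powr (- 1 / p) * X (i, j)) (mat_vec d A x))
         \<le> 4 * b * lp_norm p n (mat_vec d A x)}"
      unfolding Int_eq by (rule main) simp
  qed (use ab c in auto)
qed

end
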